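(* Consider an ISSIFS $\mathcal S$ and a probability $p$, the coin tossing integer self-similar set $\Lambda_{\mathcal S,p}$, and the expectation matrices $\mathcal M=\{\mathbf M_0=p\mathbf B_0,\dots,\mathbf M_{L-1}=p\mathbf B_{L-1}\}$. Assume that there exists a non-empty finite set $\mathcal U=\{\mathbf u_1,\dots,\mathbf u_m\}\subset\mathbb N^N\setminus\{\mathbf 0\}$ such that: (1) There exist $\mathbf u^*\in\mathcal U$, $\boldsymbol\theta^*\in[L]^{S^*}$ for some $S^*\ge1$, and $U^*\in[N]$ such that (a) $\mathbf e_{U^*}^T\mathbf B_{\boldsymbol\theta^*}\ge(\mathbf u^* )^T$; (b) for the deterministic attractor $\Lambda_{\mathcal S}$, the set $\Lambda_{\mathcal S}\cap J^{(U^* )}_{\boldsymbol\theta^*}$ contains an interior point. (2) There exist $\gamma'>1$ and a level $S'$ such that for all $\boldsymbol\theta\in[L]^{S'}$ there exists a non-negative $m\times m$ matrix $\mathbf A_{\boldsymbol\theta}$ all of whose row sums are greater than $\gamma'$ and for which $$\mathbf U\mathbf M_{\boldsymbol\theta}\ge\mathbf A_{\boldsymbol\theta}\mathbf U,$$ where $\mathbf U$ is the $m\times N$ matrix with row vectors $\mathbf u_i^T$, $i=1,\dots,m$. Then $\Lambda_{\mathcal S,p}$ contains an interval almost surely conditioned on non-extinction.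
   Context: Notation: $[k]=\{0,\dots,k-1\}$; $\mathbb N$ includes $0$ when used as a set of values. Inequalities between vectors or matrices are entrywise. $\mathbf e_U$ is the $U$-th standard basis (column) vector of $\mathbb R^N$. "Interval" means non-degenerate interval. ISSIFS: a finite list $\mathcal S=\{S_i(x)=\frac1Lx+t_i\}_{i=0}^{M-1}$ of maps of $\mathbb R$, with $L\ge2$ an integer, $t_i\in\mathbb N$, $0=t_0\le\cdots\le t_{M-1}$, and $L-1$ dividing $t_{M-1}$. Write $S_{i_1\dots i_n}=S_{i_1}\circ\cdots\circ S_{i_n}$. Its (deterministic) attractor $\Lambda_{\mathcal S}$ is the unique non-empty compact set with $\Lambda_{\mathcal S}=\bigcup_iS_i(\Lambda_{\mathcal S})$. On $\Sigma_M=[M]^{\mathbb N}$ put $\Pi(\mathbf i)=\lim_{n\to\infty}S_{i_1\dots i_n}(0)$. Let $\eta=\Pi_*\mu$, where $\mu=(\frac1M,\dots,\frac1M)^{\mathbb N}$. The basic intervals are those intervals of the form $[(i-1)L,iL]$, $i\in\mathbb Z$, having positive $\eta$-measure; there are finitely many, say $N$, written $J^{(U)}=[b_UL,(b_U+1)L]$, $U\in[N]$, $b_U\in\mathbb N$, $b_0<b_1<\dots<b_{N-1}$. For $\boldsymbol\theta=(\theta_1,\dots,\theta_n)\in[L]^n$ let $J^{(U)}_{\boldsymbol\theta}=\left[b_UL+\sum_{\ell=1}^n\theta_\ell L^{-(\ell-1)},\ b_UL+\sum_{\ell=1}^n\theta_\ell L^{-(\ell-1)}+L^{-(n-1)}\right]$.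 For $\theta\in[L]$ the $N\times N$ matrix $\mathbf B_\theta$ is $\mathbf B_\theta(i,k)=\#\{\ell\in[M]:S_\ell(J^{(k)})=J^{(i)}_\theta\}$, $i,k\in[N]$. For $\boldsymbol\theta=(\theta_1,\dots,\theta_n)$, $\mathbf B_{\boldsymbol\theta}=\mathbf B_{\theta_1}\cdots\mathbf B_{\theta_n}$ and $\mathbf M_{\boldsymbol\theta}=\mathbf M_{\theta_1}\cdots\mathbf M_{\theta_n}$. Random set: to each nonempty finite word $i_1\dots i_n$ over $[M]$ assign independent Bernoulli variables $X_{i_1\dots i_n}$ with $\mathbb P(X_{i_1\dots i_n}=1)=p$, $p\in(0,1]$. Let $\mathcal E_\infty=\{\mathbf i\in\Sigma_M:X_{i_1\dots i_n}=1\ \forall n\ge1\}$. The coin tossing integer self-similar set is $\Lambda_{\mathcal S,p}=\Pi(\mathcal E_\infty)$. Non-extinction is the event $\mathcal E_\infty\ne\emptyset$. *)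

theory Defs
  imports "HOL-Probability.Probability" "Jordan_Normal_Form.Matrix"
begin

text \<open>An ISSIFS is given by its base \<open>L\<close> and its list \<open>t\<close> of integer translations;
  the number of maps \<open>M\<close> is \<open>length t\<close>, and the set \<open>[k]\<close> is \<open>{..<k}\<close>.\<close>

definition issifs :: "nat \<Rightarrow> nat list \<Rightarrow> bool" where
  "issifs L t \<longleftrightarrow> 2 \<le> L \<and> t \<noteq> [] \<and> hd t = 0 \<and> sorted t \<and> (L - 1) dvd last t"

definition S_map :: "nat \<Rightarrow> nat list \<Rightarrow> nat \<Rightarrow> real \<Rightarrow> real" where
  "S_map L t i x = 1 / real L * x + real (t ! i)"

definition S_word :: "nat \<Rightarrow> nat list \<Rightarrow> nat list \<Rightarrow> real \<Rightarrow> real" where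
  "S_word L t w = foldr (\<lambda>i f. S_map L t i \<circ> f) w id"

text \<open>Well defined by Hutchinson's theorem.\<close>
definition attractor :: "nat \<Rightarrow> nat list \<Rightarrow> real set" where
  "attractor L t =
     (THE K. K \<noteq> {} \<and> compact K \<and> K = (\<Union>i<length t. S_map L t i ` K))"

text \<open>Infinite codes are indexed from 0, so the prefix \<open>i\<^sub>1 \<dots> i\<^sub>n\<close> is
  \<open>map c [0..<n]\<close>.\<close>

definition codes :: "nat \<Rightarrow> (nat \<Rightarrow> nat) set" where
  "codes M = (UNIV \<rightarrow> {..<M})"

definition code_prefix :: "(nat \<Rightarrow> nat) \<Rightarrow> nat \<Rightarrow> nat list" where
  "code_prefix c n = map c [0..<n]"

definition natural_proj :: "nat \<Rightarrow> nat list \<Rightarrow> (nat \<Rightarrow> nat) \<Rightarrow> real" where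
  "natural_proj L t c = lim (\<lambda>n. S_word L t (code_prefix c n) 0)"

text \<open>The underlying space of this product measure is \<open>codes M\<close>.\<close>
definition code_measure :: "nat \<Rightarrow> (nat \<Rightarrow> nat) measure" where
  "code_measure M = (\<Pi>\<^sub>M n\<in>UNIV. uniform_count_measure {..<M})"

definition eta :: "nat \<Rightarrow> nat list \<Rightarrow> real measure" where
  "eta L t = distr (code_measure (length t)) borel (natural_proj L t)"

text \<open>The integers \<open>b\<close> (that is, \<open>i - 1\<close>) for which \<open>[b L, (b + 1) L]\<close> is a basic interval.\<close>
definition basic_indices :: "nat \<Rightarrow> nat list \<Rightarrow> int set" where
  "basic_indices L t =
     {b. emeasure (eta L t) {real_of_int b * real L .. real_of_int (b + 1) * real L} > 0}"

definition num_basic :: "nat \<Rightarrow> nat list \<Rightarrow> nat" where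
  "num_basic L t = card (basic_indices L t)"

text \<open>\<open>basic_indices\<close> is finite, so this enumerates it increasingly for \<open>U < num_basic L t\<close>.\<close>
definition basic_b :: "nat \<Rightarrow> nat list \<Rightarrow> nat \<Rightarrow> int" where
  "basic_b L t U = sorted_list_of_set (basic_indices L t) ! U"

definition basic_interval :: "nat \<Rightarrow> nat list \<Rightarrow> nat \<Rightarrow> real set" where
  "basic_interval L t U =
     {real_of_int (basic_b L t U) * real L .. real_of_int (basic_b L t U + 1) * real L}"

text \<open>The list is indexed from 0, so \<open>\<theta>s ! l\<close> is \<open>\<theta>\<^bsub>l+1\<^esub>\<close>, which carries the weight
  \<open>L\<close> to the power \<open>- l\<close>.\<close>
definition subinterval :: "nat \<Rightarrow> nat list \<Rightarrow> nat \<Rightarrow> nat list \<Rightarrow> real set" where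
  "subinterval L t U \<theta>s =
     (let a = real_of_int (basic_b L t U) * real L
                + (\<Sum>l<length \<theta>s. real (\<theta>s ! l) / real L ^ l)
      in {a .. a + real L powi (- (int (length \<theta>s) - 1))})"

definition B_mat :: "nat \<Rightarrow> nat list \<Rightarrow> nat \<Rightarrow> real Matrix.mat" where
  "B_mat L t \<theta> = Matrix.mat (num_basic L t) (num_basic L t)
     (\<lambda>(i, k). real (card {l. l < length t \<and>
        S_map L t l ` basic_interval L t k = subinterval L t i [\<theta>]}))"

definition M_mat :: "nat \<Rightarrow> nat list \<Rightarrow> real \<Rightarrow> nat \<Rightarrow> real Matrix.mat" where
  "M_mat L t p \<theta> = p \<cdot>\<^sub>m B_mat L t \<theta>"

definition B_word :: "nat \<Rightarrow> nat list \<Rightarrow> nat list \<Rightarrow> real Matrix.mat" where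
  "B_word L t \<theta>s = foldr (\<lambda>\<theta> A. B_mat L t \<theta> * A) \<theta>s (1\<^sub>m (num_basic L t))"

definition M_word :: "nat \<Rightarrow> nat list \<Rightarrow> real \<Rightarrow> nat list \<Rightarrow> real Matrix.mat" where
  "M_word L t p \<theta>s = foldr (\<lambda>\<theta> A. M_mat L t p \<theta> * A) \<theta>s (1\<^sub>m (num_basic L t))"

definition finite_words :: "nat \<Rightarrow> nat \<Rightarrow> nat list set" where
  "finite_words k n = {w. length w = n \<and> set w \<subseteq> {..<k}}"

text \<open>The value \<open>True\<close> of \<open>X w\<close> stands for 1.\<close>
definition coin_tossing ::
    "'a measure \<Rightarrow> nat \<Rightarrow> real \<Rightarrow> (nat list \<Rightarrow> 'a \<Rightarrow> bool) \<Rightarrow> bool" where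
  "coin_tossing P M p X \<longleftrightarrow>
     prob_space P \<and>
     prob_space.indep_vars P (\<lambda>_. count_space UNIV) X (\<Union>n\<in>{1..}. finite_words M n) \<and>
     (\<forall>w \<in> (\<Union>n\<in>{1..}. finite_words M n).
        distr P (count_space UNIV) (X w) = measure_pmf (bernoulli_pmf p))"

definition surviving_codes ::
    "nat \<Rightarrow> (nat list \<Rightarrow> 'a \<Rightarrow> bool) \<Rightarrow> 'a \<Rightarrow> (nat \<Rightarrow> nat) set" where
  "surviving_codes M X \<omega> = {c \<in> codes M. \<forall>n\<ge>1. X (code_prefix c n) \<omega>}"

definition random_set ::
    "nat \<Rightarrow> nat list \<Rightarrow> (nat list \<Rightarrow> 'a \<Rightarrow> bool) \<Rightarrow> 'a \<Rightarrow> real set" where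
  "random_set L t X \<omega> = natural_proj L t ` surviving_codes (length t) X \<omega>"

definition contains_interval :: "real set \<Rightarrow> bool" where
  "contains_interval A \<longleftrightarrow> (\<exists>a b. a < b \<and> {a..b} \<subseteq> A)"

text \<open>The matrix whose rows are the given vectors of length \<open>N\<close>.\<close>
definition rows_mat :: "nat \<Rightarrow> nat Matrix.vec list \<Rightarrow> real Matrix.mat" where
  "rows_mat N us = mat_of_rows N (map (map_vec real) us)"

end

theory Submission
  imports Defs
begin

text \<open>
  Fix the basic interval \<open>J\<close> with index \<open>U\<^sup>*\<close> and a digit word \<open>\<theta>\<close>. The surviving words \<open>w\<close> for which
  \<open>S\<^sub>w\<close> carries some basic interval onto the subinterval \<open>J\<^sub>\<theta>\<close> form, as \<open>\<theta>\<close> is prolonged, a multitype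
  branching process: the type of \<open>w\<close> is the index of the basic interval carried, different words
  reproduce independently, and the mean matrices are the \<open>M\<^sub>\<theta>\<close>. Words are counted along paths of
  basic intervals, that is, by a deterministic automaton whose states are the indices and which
  reads one digit and one letter at a time (locale \<open>coin_automaton\<close>).

  Say that a type vector has mass \<open>R\<close> if it dominates some \<open>\<Sum>\<^sub>i c\<^sub>i u\<^sub>i\<close> with \<open>c \<ge> 0\<close> of total at
  least \<open>R\<close>. The growth hypothesis implies that the expected offspring of a population of mass \<open>R\<close>
  after \<open>S'\<close> more digits has mass \<open>\<gamma> R\<close>. As the \<open>u\<^sub>i\<close> have integer entries, dropping the small
  coefficients of the combination leaves a vector whose nonzero entries are all at least a constant
  times \<open>R\<close>; a Chernoff bound then shows that, whatever happened before, the mass fails to grow by a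
  factor \<open>\<rho> > 1\<close> with probability at most \<open>const * exp (- \<delta> R)\<close> (lemma \<open>concentration\<close>). At
  stage \<open>n\<close> there are only exponentially many digit words, while the mass is \<open>\<rho>\<^sup>n\<close>, so these
  failure probabilities are summable even after a union bound over all digit words. To have a large
  mass to begin with, let all coins up to a large finite depth succeed: this has positive
  probability, and the deterministic counts then grow as well, from the vector \<open>u\<^sup>*\<close> dominated at
  \<open>\<theta>\<^sup>*\<close>. Hence with positive
  probability the mass grows forever along \<^emph>\<open>all\<close> prolongations of \<open>\<theta>\<^sup>*\<close> at once
  (lemma \<open>prob_all_stages_pos\<close>). In that case surviving words are found near every point of
  \<open>J\<^sub>\<theta>\<^sub>*\<close> at every level, and Koenig's lemma puts the whole interval, up to its right end point, into
  the random set (lemma \<open>natural_proj_of_covered\<close>).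

  Positive probability becomes probability one given survival because every surviving word starts an
  independent copy of the process. Let \<open>a\<close> be the probability that no surviving word starts a copy
  with the covering property and \<open>e \<le> a\<close> the extinction probability. With
  \<open>g s = 1 - p + p s\<^sup>M\<close> one has \<open>e = g e\<close>, \<open>a \<le> g a\<close> and \<open>a < 1\<close>; the chord slope
  \<open>(1 - g s) / (1 - s)\<close> is strictly increasing when \<open>M \<ge> 2\<close>, which the growth hypothesis enforces, so \<open>a = e\<close>
  (lemma \<open>AE_extinct_if_barren\<close>).

  The argument is carried out for the product measure on all words; the last part transfers it to the
  given coins. There the root, too, has a coin, and a word is called live if the coins at its
  \<^emph>\<open>proper\<close> prefixes succeed. With this convention being live is multiplicative under concatenation,
  and the part of the coin field below a word is again a complete coin field.
\<close>

section \<open>A Chernoff bound for the lower tail\<close>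

lemma exp_minus_upper_bound:
  fixes z :: real
  assumes "0 \<le> z"
  shows "exp (- z) \<le> 1 - z + z\<^sup>2"
proof -
  have "1 \<le> (1 - z + z\<^sup>2) * (1 + z)"
    using assms by (simp add: algebra_simps power2_eq_square)
  also have "\<dots> \<le> (1 - z + z\<^sup>2) * exp z"
  proof (intro mult_left_mono)
    have "0 \<le> (z - 1/2)\<^sup>2 + 3/4" by simp
    also have "\<dots> = 1 - z + z\<^sup>2" by (simp add: power2_eq_square algebra_simps)
    finally show "0 \<le> 1 - z + z\<^sup>2" .
  qed (use exp_ge_add_one_self in auto)
  finally show ?thesis by (simp add: exp_minus field_simps)
qed

text \<open>Convexity: the exponential lies below its chord over \<open>[- s B, 0]\<close>. The right-hand side is affine
  in \<open>y\<close>, so its expectation depends on the mean of \<open>y\<close> only.\<close>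
lemma exp_minus_chord:
  fixes s y B :: real
  assumes "0 \<le> y" "y \<le> B" "0 < B"
  shows "exp (- (s * y)) \<le> 1 - y / B * (1 - exp (- (s * B)))"
proof -
  have "exp ((1 - y / B) *\<^sub>R 0 + (y / B) *\<^sub>R (- (s * B))) \<le>
        (1 - y / B) * exp 0 + y / B * exp (- (s * B))"
    using assms by (intro convex_onD[OF exp_convex]) auto
  then show ?thesis using assms by (simp add: algebra_simps)
qed

text \<open>The exponential Markov inequality at \<open>s = \<epsilon> / (2 B)\<close>. The exponent involves the mean only, not
  the number of summands, which matters because a population of given mass may be arbitrarily
  large. The independent event \<open>D\<close> carries the conditioning on the past, so that no conditional
  expectations are needed.\<close>
lemma (in prob_space) chernoff_lower_tail:
  fixes Y :: "'i \<Rightarrow> 'a \<Rightarrow> real"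
  assumes fin: "finite J"
    and indep: "indep_vars (\<lambda>_. borel) (case_option (indicator D) Y) (insert None (Some ` J))"
    and D: "D \<in> events"
    and Y: "\<And>j \<omega>. j \<in> J \<Longrightarrow> 0 \<le> Y j \<omega> \<and> Y j \<omega> \<le> B"
    and B: "0 < B" and eps: "0 < \<epsilon>" and a: "0 \<le> a"
    and mean: "a \<le> (\<Sum>j\<in>J. expectation (Y j))"
  shows "prob (D \<inter> {\<omega> \<in> space M. (\<Sum>j\<in>J. Y j \<omega>) < (1 - \<epsilon>) * a})
    \<le> prob D * exp (- (\<epsilon>\<^sup>2 * a / (4 * B)))"
proof -
  define s where "s = \<epsilon> / (2 * B)"
  have s: "0 < s" "s * B = \<epsilon> / 2" using B eps by (auto simp: s_def)
  have measY [measurable]: "random_variable borel (Y j)" if "j \<in> J" for j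
    using indep that unfolding indep_vars_def by force
  define V :: "'i option \<Rightarrow> 'a \<Rightarrow> real"
    where "V = (\<lambda>i \<omega>. case i of None \<Rightarrow> indicator D \<omega> | Some j \<Rightarrow> exp (- (s * Y j \<omega>)))"
  have "indep_vars (\<lambda>_. borel)
      (\<lambda>i \<omega>. (case i of None \<Rightarrow> (\<lambda>x. x) | Some j \<Rightarrow> (\<lambda>x. exp (- (s * x))))
        (case_option (indicator D) Y i \<omega>)) (insert None (Some ` J))"
    by (intro indep_vars_compose2[OF indep]) (auto split: option.splits)
  also have "(\<lambda>i \<omega>. (case i of None \<Rightarrow> (\<lambda>x. x) | Some j \<Rightarrow> (\<lambda>x. exp (- (s * x))))
        (case_option (indicator D) Y i \<omega>)) = V"
    by (auto simp: V_def fun_eq_iff split: option.splits)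
  finally have indepV: "indep_vars (\<lambda>_. borel) V (insert None (Some ` J))" .
  have intY: "integrable M (Y j)" if "j \<in> J" for j
    using that Y[OF that] by (intro integrable_const_bound[where B=B]) auto
  have intE: "integrable M (\<lambda>\<omega>. exp (- (s * Y j \<omega>)))" if "j \<in> J" for j
    using that Y[OF that] s by (intro integrable_const_bound[where B=1]) auto
  have intV: "integrable M (V i)" if "i \<in> insert None (Some ` J)" for i
    using that intE integrable_real_indicator[OF D] by (auto simp: V_def less_top[symmetric])
  have prodV: "(\<Prod>i\<in>insert None (Some ` J). V i \<omega>) = indicator D \<omega> * exp (- (s * (\<Sum>j\<in>J. Y j \<omega>)))" for \<omega>
    using fin by (simp add: prod.reindex V_def exp_sum sum_distrib_left flip: sum_negf)
  have "expectation (\<lambda>\<omega>. \<Prod>i\<in>insert None (Some ` J). V i \<omega>)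
      = (\<Prod>i\<in>insert None (Some ` J). expectation (V i))"
    using fin by (intro indep_vars_lebesgue_integral indepV intV) auto
  also have "\<dots> = prob D * (\<Prod>j\<in>J. expectation (\<lambda>\<omega>. exp (- (s * Y j \<omega>))))"
    using fin D by (simp add: prod.reindex V_def)
  finally have EV: "expectation (\<lambda>\<omega>. indicator D \<omega> * exp (- (s * (\<Sum>j\<in>J. Y j \<omega>))))
      = prob D * (\<Prod>j\<in>J. expectation (\<lambda>\<omega>. exp (- (s * Y j \<omega>))))"
    by (simp only: prodV)
  define q where "q = 1 - exp (- (s * B))"
  have q: "0 \<le> q" "\<epsilon> / 2 - (\<epsilon> / 2)\<^sup>2 \<le> q"
    using exp_minus_upper_bound[of "\<epsilon> / 2"] eps by (auto simp: q_def s)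
  \<comment> \<open>chord bound, then \<open>1 - z \<le> exp (- z)\<close>\<close>
  have one: "expectation (\<lambda>\<omega>. exp (- (s * Y j \<omega>))) \<le> exp (- (expectation (Y j) / B * q))"
    if j: "j \<in> J" for j
  proof -
    have "expectation (\<lambda>\<omega>. exp (- (s * Y j \<omega>))) \<le> expectation (\<lambda>\<omega>. 1 - Y j \<omega> / B * q)"
      using j intE intY Y[OF j] B unfolding q_def
      by (intro integral_mono exp_minus_chord Bochner_Integration.integrable_diff
          integrable_mult_left integrable_divide) auto
    also have "\<dots> = 1 - expectation (Y j) / B * q"
      using j intY by (subst Bochner_Integration.integral_diff) (auto simp: prob_space)
    also have "\<dots> \<le> exp (- (expectation (Y j) / B * q))"
      using exp_ge_add_one_self[of "- (expectation (Y j) / B * q)"] by simp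
    finally show ?thesis .
  qed
  have "prob (D \<inter> {\<omega> \<in> space M. (\<Sum>j\<in>J. Y j \<omega>) < (1 - \<epsilon>) * a})
     = expectation (indicator (D \<inter> {\<omega> \<in> space M. (\<Sum>j\<in>J. Y j \<omega>) < (1 - \<epsilon>) * a}))"
    using D sets.sets_into_space[OF D] by (simp add: Int_absorb1 inf.absorb2 inf_assoc)
  also have "\<dots> \<le> expectation (\<lambda>\<omega>. exp (s * ((1 - \<epsilon>) * a)) *
      (indicator D \<omega> * exp (- (s * (\<Sum>j\<in>J. Y j \<omega>)))))"
  proof (rule integral_mono)
    have "integrable M (\<lambda>\<omega>. \<Prod>i\<in>insert None (Some ` J). V i \<omega>)"
      using fin by (intro indep_vars_integrable indepV intV) auto
    then show "integrable M (\<lambda>\<omega>. exp (s * ((1 - \<epsilon>) * a)) *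
      (indicator D \<omega> * exp (- (s * (\<Sum>j\<in>J. Y j \<omega>)))))"
      unfolding prodV by (rule integrable_mult_right)
    fix \<omega>
    show "indicat_real (D \<inter> {\<omega> \<in> space M. (\<Sum>j\<in>J. Y j \<omega>) < (1 - \<epsilon>) * a}) \<omega>
      \<le> exp (s * ((1 - \<epsilon>) * a)) * (indicator D \<omega> * exp (- (s * (\<Sum>j\<in>J. Y j \<omega>))))"
      using s by (auto simp: indicator_def mult_exp_exp simp flip: right_diff_distrib)
  next
    have "D \<inter> {\<omega> \<in> space M. (\<Sum>j\<in>J. Y j \<omega>) < (1 - \<epsilon>) * a} \<in> events"
      using D by measurable
    then show "integrable M (indicat_real (D \<inter> {\<omega> \<in> space M. (\<Sum>j\<in>J. Y j \<omega>) < (1 - \<epsilon>) * a}))"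
      by (intro integrable_real_indicator) (auto simp: less_top[symmetric])
  qed
  also have "\<dots> = exp (s * ((1 - \<epsilon>) * a)) *
      (prob D * (\<Prod>j\<in>J. expectation (\<lambda>\<omega>. exp (- (s * Y j \<omega>)))))"
    by (simp add: EV)
  also have "\<dots> \<le> exp (s * ((1 - \<epsilon>) * a)) *
      (prob D * (\<Prod>j\<in>J. exp (- (expectation (Y j) / B * q))))"
    by (intro mult_left_mono prod_mono conjI one Bochner_Integration.integral_nonneg) auto
  also have "(\<Prod>j\<in>J. exp (- (expectation (Y j) / B * q)))
      = exp (- ((\<Sum>j\<in>J. expectation (Y j)) / B * q))"
    using fin by (simp add: exp_sum sum_divide_distrib sum_distrib_right flip: sum_negf)
  also have "\<dots> \<le> exp (- (a / B * (\<epsilon> / 2 - (\<epsilon> / 2)\<^sup>2)))"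
  proof -
    have "a / B * (\<epsilon> / 2 - (\<epsilon> / 2)\<^sup>2) \<le> a / B * q"
      using q a B by (intro mult_left_mono) auto
    also have "\<dots> \<le> (\<Sum>j\<in>J. expectation (Y j)) / B * q"
      using mean q B by (intro mult_right_mono divide_right_mono) auto
    finally show ?thesis by simp
  qed
  also have "exp (s * ((1 - \<epsilon>) * a)) * (prob D * exp (- (a / B * (\<epsilon> / 2 - (\<epsilon> / 2)\<^sup>2))))
     = prob D * exp (- (\<epsilon>\<^sup>2 * a / (4 * B)))"
  proof -
    have "s * ((1 - \<epsilon>) * a) + - (a / B * (\<epsilon> / 2 - (\<epsilon> / 2)\<^sup>2)) = - (\<epsilon>\<^sup>2 * a / (4 * B))"
      using B by (simp add: s_def field_simps power2_eq_square)
    then show ?thesis by (simp add: mult_exp_exp mult.left_commute)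
  qed
  finally show ?thesis by (simp add: mult_left_mono)
qed

section \<open>Independent coins on the words\<close>

definition coin_field :: "real \<Rightarrow> (nat list \<Rightarrow> bool) measure" where
  "coin_field p = (\<Pi>\<^sub>M v\<in>UNIV. measure_pmf (bernoulli_pmf p))"

definition coins_at :: "nat list \<Rightarrow> (nat list \<Rightarrow> bool) \<Rightarrow> nat list \<Rightarrow> bool" where
  "coins_at w x = (\<lambda>v. x (w @ v))"

text \<open>Only proper prefixes are tested, and the empty word is one of them unless \<open>w\<close> is empty itself. The
  nodes tested by \<open>v @ w\<close> are therefore those tested by \<open>v\<close> together with the nodes \<open>v @ u\<close>
  for \<open>u\<close> tested by \<open>w\<close>, without overlap.\<close>
definition live :: "(nat list \<Rightarrow> bool) \<Rightarrow> nat list \<Rightarrow> bool" where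
  "live x w \<longleftrightarrow> (\<forall>n<length w. x (take n w))"

definition depends_on :: "'v set \<Rightarrow> (('v \<Rightarrow> bool) \<Rightarrow> 'b) \<Rightarrow> bool" where
  "depends_on K f \<longleftrightarrow> (\<forall>x y. (\<forall>v\<in>K. x v = y v) \<longrightarrow> f x = f y)"

lemma depends_onD: "depends_on K f \<Longrightarrow> (\<And>v. v \<in> K \<Longrightarrow> x v = y v) \<Longrightarrow> f x = f y"
  by (auto simp: depends_on_def)

lemma coins_at_Nil [simp]: "coins_at [] x = x"
  by (simp add: coins_at_def)

lemma coins_at_coins_at: "coins_at v (coins_at w x) = coins_at (w @ v) x"
  by (simp add: coins_at_def)

lemma live_Nil [simp]: "live x []"
  by (simp add: live_def)

lemma live_Cons: "live x (i # w) \<longleftrightarrow> x [] \<and> live (coins_at [i] x) w"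
  by (auto simp: live_def coins_at_def less_Suc_eq_0_disj)

lemma live_append: "live x (v @ w) \<longleftrightarrow> live x v \<and> live (coins_at v x) w"
  by (induction v arbitrary: x) (auto simp: live_Cons coins_at_coins_at)

lemma live_cong:
  assumes "\<And>n. n < length w \<Longrightarrow> x (take n w) = y (take n w)"
  shows "live x w = live y w"
  using assms by (auto simp: live_def)

lemma prob_space_coin_field: "prob_space (coin_field p)"
  unfolding coin_field_def by (intro prob_space_PiM prob_space_measure_pmf)

interpretation coins: prob_space "coin_field p" for p
  by (rule prob_space_coin_field)

lemma space_coin_field [simp]: "space (coin_field p) = UNIV"
  by (simp add: coin_field_def space_PiM PiE_def extensional_def)

lemma sets_coin_field: "sets (coin_field p) = sets (\<Pi>\<^sub>M v\<in>UNIV. count_space UNIV)"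
  unfolding coin_field_def by (intro sets_PiM_cong) auto

lemma measurable_coin [measurable]: "(\<lambda>\<omega>. \<omega> v) \<in> coin_field p \<rightarrow>\<^sub>M count_space UNIV"
  unfolding measurable_cong_sets[OF sets_coin_field refl] by simp

lemma measurable_coins_at [measurable]: "coins_at w \<in> coin_field p \<rightarrow>\<^sub>M coin_field p"
proof -
  have "coins_at w \<in> coin_field p \<rightarrow>\<^sub>M (\<Pi>\<^sub>M v\<in>UNIV. count_space UNIV)"
    unfolding coins_at_def by (intro measurable_PiM_single') (auto simp: PiE_def extensional_def)
  then show ?thesis
    unfolding measurable_cong_sets[OF refl sets_coin_field] .
qed

lemma distr_coins_at: "distr (coin_field p) (coin_field p) (coins_at w) = coin_field p"
proof -
  have "distr (coin_field p) (coin_field p) (\<lambda>\<omega>. \<lambda>v\<in>UNIV. \<omega> (w @ v)) = coin_field p"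
    unfolding coin_field_def
    by (rule distr_PiM_reindex) (auto intro: prob_space_measure_pmf inj_onI)
  moreover have "(\<lambda>\<omega>. \<lambda>v\<in>UNIV. \<omega> (w @ v)) = coins_at w"
    by (auto simp: coins_at_def fun_eq_iff)
  ultimately show ?thesis by simp
qed

lemma measure_coins_at:
  assumes "Q \<in> sets (coin_field p)"
  shows "coins.prob p {\<omega>. coins_at w \<omega> \<in> Q} = coins.prob p Q"
proof -
  have "coins.prob p Q = measure (distr (coin_field p) (coin_field p) (coins_at w)) Q"
    by (simp add: distr_coins_at)
  also have "\<dots> = coins.prob p {\<omega>. coins_at w \<omega> \<in> Q}"
    using assms by (subst measure_distr) (auto simp: vimage_def)
  finally show ?thesis ..
qed

text \<open>A function of finitely many coins factors through a finite discrete space, hence is measurable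
  whatever it is.\<close>
lemma measurable_depends_on:
  assumes "depends_on K f" "finite K" "space N = UNIV"
  shows "f \<in> coin_field p \<rightarrow>\<^sub>M N"
proof -
  have r: "(\<lambda>\<omega>. restrict \<omega> K) \<in> coin_field p \<rightarrow>\<^sub>M (\<Pi>\<^sub>M v\<in>K. count_space UNIV)"
    by (intro measurable_restrict) measurable
  have eq: "(\<Pi>\<^sub>M v\<in>K. count_space (UNIV :: bool set)) = count_space (PiE K (\<lambda>_. UNIV))"
    using assms by (intro count_space_PiM_finite) auto
  have "(\<lambda>\<omega>. f (restrict \<omega> K)) \<in> coin_field p \<rightarrow>\<^sub>M N"
    by (rule measurable_compose[OF r]) (use assms in \<open>simp add: eq\<close>)
  also have "(\<lambda>\<omega>. f (restrict \<omega> K)) = f"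
    by (auto intro!: depends_onD[OF assms(1)])
  finally show ?thesis .
qed

lemma indep_vars_coordinates: "coins.indep_vars p (\<lambda>_. count_space UNIV) (\<lambda>v \<omega>. \<omega> v) UNIV"
proof (subst coins.indep_vars_iff_distr_eq_PiM)
  have "distr (coin_field p) (count_space UNIV) (\<lambda>\<omega>. \<omega> v) = measure_pmf (bernoulli_pmf p)" for v
  proof -
    have "distr (coin_field p) (measure_pmf (bernoulli_pmf p)) (\<lambda>\<omega>. \<omega> v) = measure_pmf (bernoulli_pmf p)"
      unfolding coin_field_def by (rule distr_PiM_component) (auto intro: prob_space_measure_pmf)
    moreover have "distr (coin_field p) (count_space UNIV) (\<lambda>\<omega>. \<omega> v) =
        distr (coin_field p) (measure_pmf (bernoulli_pmf p)) (\<lambda>\<omega>. \<omega> v)"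
      by (intro distr_cong) auto
    ultimately show ?thesis by simp
  qed
  moreover have "distr (coin_field p) (\<Pi>\<^sub>M v\<in>UNIV. count_space UNIV) (\<lambda>\<omega>. \<lambda>v\<in>UNIV. \<omega> v) = coin_field p"
  proof -
    have "distr (coin_field p) (\<Pi>\<^sub>M v\<in>UNIV. count_space UNIV) (\<lambda>\<omega>. \<lambda>v\<in>UNIV. \<omega> v)
        = distr (coin_field p) (coin_field p) (\<lambda>\<omega>. \<omega>)"
      by (intro distr_cong) (auto simp: sets_coin_field)
    then show ?thesis by (simp add: distr_id)
  qed
  ultimately show "distr (coin_field p) (\<Pi>\<^sub>M v\<in>UNIV. count_space UNIV) (\<lambda>\<omega>. \<lambda>v\<in>UNIV. \<omega> v) =
      (\<Pi>\<^sub>M v\<in>UNIV. distr (coin_field p) (count_space UNIV) (\<lambda>\<omega>. \<omega> v))"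
    by (simp add: coin_field_def)
qed auto

text \<open>Grouping of independent coins. The auxiliary map \<open>e\<close> fills the coins outside a group with a
  constant, which turns a function on the whole field that depends on the group only into a
  measurable function on the product over the group.\<close>
lemma indep_vars_depends_on:
  assumes disj: "disjoint_family_on K J"
    and dep: "\<And>j. j \<in> J \<Longrightarrow> depends_on (K j) (f j)"
    and meas: "\<And>j. j \<in> J \<Longrightarrow> f j \<in> coin_field p \<rightarrow>\<^sub>M N j"
  shows "coins.indep_vars p N f J"
proof -
  define e where "e j y = (\<lambda>v. if v \<in> K j then y v else False)" for j and y :: "nat list \<Rightarrow> bool"
  have e: "e j \<in> (\<Pi>\<^sub>M v\<in>K j. count_space UNIV) \<rightarrow>\<^sub>M coin_field p" for j
  proof -
    have "e j \<in> (\<Pi>\<^sub>M v\<in>K j. count_space UNIV) \<rightarrow>\<^sub>M (\<Pi>\<^sub>M v\<in>UNIV. count_space UNIV)"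
      unfolding e_def by (intro measurable_PiM_single') (auto simp: PiE_def extensional_def)
    then show ?thesis unfolding measurable_cong_sets[OF refl sets_coin_field] .
  qed
  have "coins.indep_vars p (\<lambda>j. \<Pi>\<^sub>M v\<in>K j. count_space UNIV) (\<lambda>j \<omega>. \<lambda>v\<in>K j. \<omega> v) J"
    by (intro coins.indep_vars_restrict[OF indep_vars_coordinates] disj) auto
  then have "coins.indep_vars p N (\<lambda>j \<omega>. (f j \<circ> e j) (restrict \<omega> (K j))) J"
    by (rule coins.indep_vars_compose2) (auto simp: comp_def intro: measurable_compose[OF e meas])
  also have "?this \<longleftrightarrow> ?thesis"
    by (intro coins.indep_vars_cong refl)
      (auto simp: e_def fun_eq_iff intro!: depends_onD[OF dep])
  finally show ?thesis .
qed

lemma prob_all_coins: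
  assumes "0 \<le> p" "p \<le> 1" "finite U"
  shows "coins.prob p {\<omega>. \<forall>v\<in>U. \<omega> v} = p ^ card U"
proof -
  interpret pr: product_prob_space "\<lambda>_::nat list. measure_pmf (bernoulli_pmf p)" UNIV
    by unfold_locales
  have "emeasure (coin_field p) {\<omega> \<in> space (coin_field p). \<forall>v\<in>U. \<omega> v \<in> {True}}
      = (\<Prod>v\<in>U. emeasure (measure_pmf (bernoulli_pmf p)) {True})"
    unfolding coin_field_def using assms by (intro pr.emeasure_PiM_Collect) auto
  also have "\<dots> = ennreal (p ^ card U)"
    using assms by (simp add: emeasure_pmf_single ennreal_power)
  finally show ?thesis using assms by (simp add: measure_def)
qed

lemma prob_live:
  assumes "0 \<le> p" "p \<le> 1"
  shows "coins.prob p {\<omega>. live \<omega> w} = p ^ length w"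
proof -
  have "inj_on (\<lambda>n. take n w) {..<length w}"
    by (auto intro!: inj_onI dest: arg_cong[of _ _ length])
  then have "card ((\<lambda>n. take n w) ` {..<length w}) = length w"
    by (simp add: card_image)
  moreover have "{\<omega>. live \<omega> w} = {\<omega>. \<forall>v\<in>(\<lambda>n. take n w) ` {..<length w}. \<omega> v}"
    by (auto simp: live_def)
  ultimately show ?thesis using prob_all_coins[OF assms, of "(\<lambda>n. take n w) ` {..<length w}"] by simp
qed

text \<open>The generating function of the branching process: the coin at the root and the \<open>M\<close> fields below
  its children are independent, and each of these fields has the law of the whole field.\<close>
lemma prob_root_branching:
  assumes p: "0 \<le> p" "p \<le> 1" and Q: "Q \<in> sets (coin_field p)"
  shows "coins.prob p {\<omega>. \<omega> [] \<longrightarrow> (\<forall>i<M. coins_at [i] \<omega> \<in> Q)} = 1 - p + p * coins.prob p Q ^ M"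
proof -
  define f where "f j \<omega> = (case j of None \<Rightarrow> \<omega> [] | Some i \<Rightarrow> coins_at [i] \<omega> \<in> Q)"
    for j and \<omega> :: "nat list \<Rightarrow> bool"
  define K where "K j = (case j of None \<Rightarrow> {[]} | Some i \<Rightarrow> range ((#) i))" for j :: "nat option"
  have meas [measurable]: "(\<lambda>\<omega>. coins_at [i] \<omega> \<in> Q) \<in> coin_field p \<rightarrow>\<^sub>M count_space UNIV" for i
    using Q by measurable
  have ind: "coins.indep_vars p (\<lambda>_. count_space UNIV) f (insert None (Some ` {..<M}))"
  proof (rule indep_vars_depends_on)
    show "disjoint_family_on K (insert None (Some ` {..<M}))"
      by (auto simp: disjoint_family_on_def K_def)
    fix j assume "j \<in> insert None (Some ` {..<M})"
    show "depends_on (K j) (f j)"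
    proof (cases j)
      case (Some i)
      have eq: "coins_at [i] x = coins_at [i] y" if "\<forall>v\<in>range ((#) i). x v = y v" for x y
        using that by (auto simp: coins_at_def)
      have Kj: "K j = range ((#) i)" and fj: "f j = (\<lambda>\<omega>. coins_at [i] \<omega> \<in> Q)"
        using Some by (auto simp: K_def f_def)
      show ?thesis
        unfolding depends_on_def Kj fj by (intro allI impI) (simp only: eq)
    qed (auto simp: depends_on_def K_def f_def)
    show "f j \<in> coin_field p \<rightarrow>\<^sub>M count_space UNIV"
    proof (cases j)
      case None
      then have "f j = (\<lambda>\<omega>. \<omega> [])" by (auto simp: f_def)
      then show ?thesis by simp
    next
      case (Some i)
      then have "f j = (\<lambda>\<omega>. coins_at [i] \<omega> \<in> Q)" by (auto simp: f_def)
      then show ?thesis using meas[of i] by (simp only:)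
    qed
  qed
  have "{\<omega>. \<omega> [] \<and> (\<forall>i<M. coins_at [i] \<omega> \<in> Q)}
      = (\<Inter>j\<in>insert None (Some ` {..<M}). f j -` {True} \<inter> space (coin_field p))"
    by (simp add: f_def set_eq_iff) (simp add: Ball_def)
  then have "coins.prob p {\<omega>. \<omega> [] \<and> (\<forall>i<M. coins_at [i] \<omega> \<in> Q)}
      = coins.prob p (\<Inter>j\<in>insert None (Some ` {..<M}). f j -` {True} \<inter> space (coin_field p))"
    by simp
  also have "\<dots> = (\<Prod>j\<in>insert None (Some ` {..<M}). coins.prob p (f j -` {True} \<inter> space (coin_field p)))"
    by (intro coins.indep_varsD_finite[OF ind]) auto
  also have "\<dots> = coins.prob p {\<omega>. \<omega> []} * (\<Prod>i<M. coins.prob p {\<omega>. coins_at [i] \<omega> \<in> Q})"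
    by (simp add: prod.reindex f_def vimage_def)
  also have "\<dots> = p * coins.prob p Q ^ M"
    using prob_all_coins[OF p, of "{[]}"] by (simp add: measure_coins_at[OF Q])
  finally have both: "coins.prob p {\<omega>. \<omega> [] \<and> (\<forall>i<M. coins_at [i] \<omega> \<in> Q)} = p * coins.prob p Q ^ M" .
  have "coins.prob p {\<omega>. \<omega> [] \<longrightarrow> (\<forall>i<M. coins_at [i] \<omega> \<in> Q)} =
      coins.prob p ({\<omega>. \<not> \<omega> []} \<union> {\<omega>. \<omega> [] \<and> (\<forall>i<M. coins_at [i] \<omega> \<in> Q)})"
    by (rule arg_cong[where f="coins.prob p"]) blast
  also have "\<dots> = coins.prob p {\<omega>. \<not> \<omega> []} + coins.prob p {\<omega>. \<omega> [] \<and> (\<forall>i<M. coins_at [i] \<omega> \<in> Q)}"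
  proof (rule coins.finite_measure_Union)
    have "{\<omega> \<in> space (coin_field p). \<not> \<omega> []} \<in> sets (coin_field p)" by measurable
    then show "{\<omega>. \<not> \<omega> []} \<in> sets (coin_field p)" by simp
    have "{\<omega> \<in> space (coin_field p). \<omega> [] \<and> (\<forall>i<M. coins_at [i] \<omega> \<in> Q)} \<in> sets (coin_field p)" by measurable
    then show "{\<omega>. \<omega> [] \<and> (\<forall>i<M. coins_at [i] \<omega> \<in> Q)} \<in> sets (coin_field p)" by simp
  qed auto
  also have "coins.prob p {\<omega>. \<not> \<omega> []} = 1 - p"
  proof -
    have "coins.prob p {\<omega> \<in> space (coin_field p). \<not> \<omega> []} = 1 - coins.prob p {\<omega> \<in> space (coin_field p). \<omega> []}"
      by (intro coins.prob_neg) measurable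
    then show ?thesis using prob_all_coins[OF p, of "{[]}"] by simp
  qed
  finally show ?thesis by (simp only: both)
qed

lemma sets_depends_on:
  assumes "depends_on K P" "finite K"
  shows "{\<omega>. P \<omega>} \<in> sets (coin_field p)"
  using measurable_depends_on[OF assms, of "count_space UNIV" p] by (simp add: pred_def)

text \<open>Conditioning on finitely many coins: an event decided by them is a finite disjoint union of cells on
  which these coins are prescribed, so a bound that holds on each cell holds on the event.\<close>
lemma prob_conditional_le:
  assumes K: "finite K" and dep: "depends_on K \<Phi>" and bad: "bad \<in> sets (coin_field p)"
    and cell: "\<And>\<sigma>. \<Phi> \<sigma> \<Longrightarrow> coins.prob p ({\<omega>. \<forall>v\<in>K. \<omega> v = \<sigma> v} \<inter> bad)
        \<le> coins.prob p {\<omega>. \<forall>v\<in>K. \<omega> v = \<sigma> v} * e"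
  shows "coins.prob p ({\<omega>. \<Phi> \<omega>} \<inter> bad) \<le> coins.prob p {\<omega>. \<Phi> \<omega>} * e"
proof -
  define T where "T = {B \<in> Pow K. \<Phi> (\<lambda>v. v \<in> B)}"
  define cell where "cell B = {\<omega>. \<forall>v\<in>K. \<omega> v = (v \<in> B)}" for B
  have finT: "finite T" using K by (simp add: T_def)
  have cell_sets: "cell B \<in> sets (coin_field p)" for B
    unfolding cell_def by (intro sets_depends_on[OF _ K]) (auto simp: depends_on_def)
  have union: "{\<omega>. \<Phi> \<omega>} = (\<Union>B\<in>T. cell B)"
  proof (intro equalityI subsetI)
    fix \<omega> assume "\<omega> \<in> {\<omega>. \<Phi> \<omega>}"
    then have "\<Phi> (\<lambda>v. v \<in> {v \<in> K. \<omega> v})"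
      using depends_onD[OF dep, of "\<lambda>v. v \<in> {v \<in> K. \<omega> v}" \<omega>] by simp
    then show "\<omega> \<in> (\<Union>B\<in>T. cell B)"
      by (intro UN_I[of "{v \<in> K. \<omega> v}"]) (auto simp: T_def cell_def)
  next
    fix \<omega> assume "\<omega> \<in> (\<Union>B\<in>T. cell B)"
    then obtain B where "B \<in> T" "\<omega> \<in> cell B" by blast
    then show "\<omega> \<in> {\<omega>. \<Phi> \<omega>}"
      using depends_onD[OF dep, of \<omega> "\<lambda>v. v \<in> B"] by (simp add: T_def cell_def)
  qed
  have disj: "disjoint_family_on cell T"
    by (auto simp: disjoint_family_on_def cell_def T_def)
  have "coins.prob p ({\<omega>. \<Phi> \<omega>} \<inter> bad) = coins.prob p (\<Union>B\<in>T. cell B \<inter> bad)"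
    by (simp add: union)
  also have "\<dots> \<le> (\<Sum>B\<in>T. coins.prob p (cell B \<inter> bad))"
    using finT cell_sets bad by (intro coins.finite_measure_subadditive_finite) auto
  also have "\<dots> \<le> (\<Sum>B\<in>T. coins.prob p (cell B) * e)"
    unfolding cell_def by (intro sum_mono cell) (simp add: T_def)
  also have "\<dots> = coins.prob p {\<omega>. \<Phi> \<omega>} * e"
    unfolding union using finT cell_sets disj
    by (subst coins.finite_measure_finite_Union) (auto simp: sum_distrib_right)
  finally show ?thesis .
qed

section \<open>Finite words and infinite codes\<close>

lemma finite_finite_words [simp]: "finite (finite_words M n)"
proof -
  have "finite_words M n = {w. set w \<subseteq> {..<M} \<and> length w = n}" by (auto simp: finite_words_def)
  then show ?thesis by (simp add: finite_lists_length_eq)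
qed

lemma card_finite_words: "card (finite_words M n) = M ^ n"
proof -
  have "finite_words M n = {w. set w \<subseteq> {..<M} \<and> length w = n}" by (auto simp: finite_words_def)
  then show ?thesis by (simp add: card_lists_length_eq)
qed

lemma finite_words_0 [simp]: "finite_words M 0 = {[]}"
  by (auto simp: finite_words_def)

lemma finite_words_Suc: "finite_words M (Suc n) = (\<Union>i<M. (#) i ` finite_words M n)"
  by (auto simp: finite_words_def length_Suc_conv)

lemma Cons_in_finite_words: "i # w \<in> finite_words M (Suc n) \<longleftrightarrow> i < M \<and> w \<in> finite_words M n"
  by (auto simp: finite_words_def)

lemma append_in_finite_words:
  "length v = n \<Longrightarrow> v @ w \<in> finite_words M (n + k) \<longleftrightarrow> v \<in> finite_words M n \<and> w \<in> finite_words M k"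
  by (auto simp: finite_words_def)

lemma take_in_finite_words: "w \<in> finite_words M n \<Longrightarrow> k \<le> n \<Longrightarrow> take k w \<in> finite_words M k"
  by (auto simp: finite_words_def dest: in_set_takeD)

lemma drop_in_finite_words: "w \<in> finite_words M n \<Longrightarrow> drop k w \<in> finite_words M (n - k)"
  by (auto simp: finite_words_def dest: in_set_dropD)

lemma length_finite_words: "w \<in> finite_words M n \<Longrightarrow> length w = n"
  by (simp add: finite_words_def)

text \<open>Koenig's lemma: from a word with \<open>T\<close>-prolongations of every length one can always pass to a
  child with the same property.\<close>
lemma koenig_codes:
  assumes ex: "\<And>n. \<exists>w\<in>finite_words M n. T w"
    and prefix: "\<And>v w. T (v @ w) \<Longrightarrow> T v"
  shows "\<exists>c\<in>codes M. \<forall>n. T (code_prefix c n)"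
proof -
  define G where "G v \<longleftrightarrow> (\<forall>n. \<exists>w\<in>finite_words M n. T (v @ w))" for v
  have step: "\<exists>i<M. G (v @ [i])" if "G v" for v
  proof (rule ccontr)
    assume "\<not> ?thesis"
    then have "\<forall>i<M. \<exists>n. \<forall>w\<in>finite_words M n. \<not> T ((v @ [i]) @ w)"
      unfolding G_def by blast
    then obtain f where f: "\<And>i w. i < M \<Longrightarrow> w \<in> finite_words M (f i) \<Longrightarrow> \<not> T ((v @ [i]) @ w)"
      by metis
    define n where "n = Max (f ` {..<M})"
    obtain w where w: "w \<in> finite_words M (Suc n)" "T (v @ w)"
      using \<open>G v\<close> unfolding G_def by blast
    then obtain i u where iu: "w = i # u" "i < M" "u \<in> finite_words M n"
      by (cases w) (auto simp: finite_words_def)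
    have "f i \<le> n" using iu by (auto simp: n_def)
    then have "take (f i) u \<in> finite_words M (f i)" using iu take_in_finite_words by blast
    moreover have "T ((v @ [i]) @ take (f i) u)"
      using prefix[of "(v @ [i]) @ take (f i) u" "drop (f i) u"] w iu by simp
    ultimately show False using f iu by blast
  qed
  define g where "g = (\<lambda>v. SOME i. i < M \<and> G (v @ [i]))"
  have g: "g v < M \<and> G (v @ [g v])" if "G v" for v
    unfolding g_def using someI_ex[of "\<lambda>i. i < M \<and> G (v @ [i])"] step[OF that] by blast
  define vs where "vs = rec_nat [] (\<lambda>_ v. v @ [g v])"
  have vs: "vs 0 = []" "vs (Suc n) = vs n @ [g (vs n)]" for n by (simp_all add: vs_def)
  have G: "G (vs n)" for n
  proof (induction n)
    case 0
    then show ?case using ex by (simp add: G_def vs)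
  qed (simp add: vs g)
  have "code_prefix (\<lambda>n. g (vs n)) n = vs n" for n
    by (induction n) (simp_all add: code_prefix_def vs)
  moreover have "T (vs n)" for n
    using G[of n] prefix unfolding G_def by blast
  ultimately show ?thesis
    using g[OF G] by (intro bexI[of _ "\<lambda>n. g (vs n)"]) (auto simp: codes_def)
qed

section \<open>Counting surviving words along a digit word\<close>

text \<open>\<open>E i \<theta> l k\<close> is the transition from state \<open>i\<close> to state \<open>k\<close> on reading digit \<open>\<theta>\<close> and letter
  \<open>l\<close>. Determinism makes the last state a function of the words read, so a word has at most one type.\<close>
locale coin_automaton =
  fixes E :: "nat \<Rightarrow> nat \<Rightarrow> nat \<Rightarrow> nat \<Rightarrow> bool" and N M :: nat and p :: real
  assumes determ: "\<And>i \<theta> l k k'. E i \<theta> l k \<Longrightarrow> E i \<theta> l k' \<Longrightarrow> k < N \<Longrightarrow> k' < N \<Longrightarrow> k = k'"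
    and p_pos: "0 < p" and p_le: "p \<le> 1"
begin

fun reach :: "nat \<Rightarrow> nat list \<Rightarrow> nat list \<Rightarrow> nat \<Rightarrow> bool" where
  "reach i [] [] k \<longleftrightarrow> i = k"
| "reach i (\<theta> # \<theta>s) (l # w) k \<longleftrightarrow> (\<exists>j<N. E i \<theta> l j \<and> reach j \<theta>s w k)"
| "reach i _ _ k \<longleftrightarrow> False"

lemma reach_determ: "reach i \<theta>s w k \<Longrightarrow> reach i \<theta>s w k' \<Longrightarrow> k = k'"
proof (induction i \<theta>s w k rule: reach.induct)
  case (2 i \<theta> \<theta>s l w k)
  then show ?case using determ by (metis reach.simps(2))
qed auto

lemma reach_append:
  "length v = length \<theta>s \<Longrightarrow> i < N \<Longrightarrow>
    reach i (\<theta>s @ \<theta>t) (v @ w) k \<longleftrightarrow> (\<exists>j<N. reach i \<theta>s v j \<and> reach j \<theta>t w k)"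
proof (induction v \<theta>s arbitrary: i rule: list_induct2)
  case (Cons l v \<theta> \<theta>s)
  have "reach i ((\<theta> # \<theta>s) @ \<theta>t) ((l # v) @ w) k \<longleftrightarrow>
      (\<exists>h<N. E i \<theta> l h \<and> (\<exists>j<N. reach h \<theta>s v j \<and> reach j \<theta>t w k))"
    using Cons.IH by simp blast
  also have "\<dots> \<longleftrightarrow> (\<exists>j<N. reach i (\<theta> # \<theta>s) (l # v) j \<and> reach j \<theta>t w k)"
    by simp blast
  finally show ?case .
qed simp

text \<open>The entries of the matrices \<open>B\<^sub>\<theta>\<close>, for one digit and for a digit word.\<close>
definition letter_count :: "nat \<Rightarrow> nat \<Rightarrow> nat \<Rightarrow> real" where
  "letter_count \<theta> i k = real (card {l. l < M \<and> E i \<theta> l k})"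

definition word_count :: "nat list \<Rightarrow> nat \<Rightarrow> nat \<Rightarrow> real" where
  "word_count \<theta>s i k = real (card {w \<in> finite_words M (length \<theta>s). reach i \<theta>s w k})"

lemma word_count_Nil: "word_count [] i k = (if i = k then 1 else 0)"
proof -
  have "{w \<in> finite_words M (length []). reach i [] w k} = (if i = k then {[]} else {})" by auto
  then show ?thesis by (simp add: word_count_def)
qed

lemma word_count_Cons: "word_count (\<theta> # \<theta>s) i k = (\<Sum>j<N. letter_count \<theta> i j * word_count \<theta>s j k)"
proof -
  define A where "A j = {l. l < M \<and> E i \<theta> l j}" for j
  define C where "C j = {w \<in> finite_words M (length \<theta>s). reach j \<theta>s w k}" for j
  have "{w \<in> finite_words M (length (\<theta> # \<theta>s)). reach i (\<theta> # \<theta>s) w k}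
      = (\<Union>j<N. (\<lambda>(l, w). l # w) ` (A j \<times> C j))"
    by (auto simp: finite_words_Suc A_def C_def image_iff)
  also have "card \<dots> = (\<Sum>j<N. card ((\<lambda>(l, w). l # w) ` (A j \<times> C j)))"
    by (intro card_UN_disjoint) (auto simp: A_def C_def dest: determ)
  also have "\<dots> = (\<Sum>j<N. card (A j) * card (C j))"
    by (intro sum.cong refl) (simp add: card_image inj_on_def card_cartesian_product)
  finally show ?thesis by (simp add: word_count_def letter_count_def A_def C_def)
qed

text \<open>The type vector of the branching process driven by the digit word \<open>\<theta>s\<close>.\<close>
definition live_count :: "(nat list \<Rightarrow> bool) \<Rightarrow> nat \<Rightarrow> nat list \<Rightarrow> nat \<Rightarrow> real" where
  "live_count x i \<theta>s k = real (card {w \<in> finite_words M (length \<theta>s). live x w \<and> reach i \<theta>s w k})"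

lemma live_count_nonneg: "0 \<le> live_count x i \<theta>s k"
  by (simp add: live_count_def)

lemma live_count_le: "live_count x i \<theta>s k \<le> real M ^ length \<theta>s"
proof -
  have "card {w \<in> finite_words M (length \<theta>s). live x w \<and> reach i \<theta>s w k} \<le> card (finite_words M (length \<theta>s))"
    by (intro card_mono) auto
  then show ?thesis by (simp add: live_count_def card_finite_words flip: of_nat_power)
qed

lemma live_count_eq_word_count:
  assumes "\<And>w. length w < length \<theta>s \<Longrightarrow> set w \<subseteq> {..<M} \<Longrightarrow> x w"
  shows "live_count x i \<theta>s k = word_count \<theta>s i k"
proof -
  have "live x w" if "w \<in> finite_words M (length \<theta>s)" for w
    unfolding live_def
  proof (intro allI impI assms)
    fix n assume "n < length w"
    then show "length (take n w) < length \<theta>s" "set (take n w) \<subseteq> {..<M}"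
      using that by (auto simp: finite_words_def dest: in_set_takeD)
  qed
  then have "{w \<in> finite_words M (length \<theta>s). live x w \<and> reach i \<theta>s w k}
      = {w \<in> finite_words M (length \<theta>s). reach i \<theta>s w k}" by blast
  then show ?thesis unfolding live_count_def word_count_def by simp
qed

lemma live_count_cong:
  assumes "\<And>w. length w < length \<theta>s \<Longrightarrow> set w \<subseteq> {..<M} \<Longrightarrow> x w = y w"
  shows "live_count x i \<theta>s k = live_count y i \<theta>s k"
proof -
  have "live x w = live y w" if "w \<in> finite_words M (length \<theta>s)" for w
  proof (intro live_cong assms)
    fix n assume "n < length w"
    then show "length (take n w) < length \<theta>s" "set (take n w) \<subseteq> {..<M}"
      using that by (auto simp: finite_words_def dest: in_set_takeD)
  qed
  then have "{w \<in> finite_words M (length \<theta>s). live x w \<and> reach i \<theta>s w k}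
      = {w \<in> finite_words M (length \<theta>s). live y w \<and> reach i \<theta>s w k}" by blast
  then show ?thesis unfolding live_count_def by simp
qed

text \<open>The state \<open>j\<close> is determined by \<open>w\<close>; it is recorded so that sums over individuals can use it.\<close>
definition ancestors :: "(nat list \<Rightarrow> bool) \<Rightarrow> nat \<Rightarrow> nat list \<Rightarrow> (nat list \<times> nat) set" where
  "ancestors x i \<theta>s = {(w, j). w \<in> finite_words M (length \<theta>s) \<and> live x w \<and> j < N \<and> reach i \<theta>s w j}"

lemma finite_ancestors: "finite (ancestors x i \<theta>s)"
  by (rule finite_subset[of _ "finite_words M (length \<theta>s) \<times> {..<N}"]) (auto simp: ancestors_def)

text \<open>The branching property: the population after \<open>\<theta>s @ \<theta>t\<close> splits according to the ancestor at time
  \<open>length \<theta>s\<close>.\<close>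
lemma live_count_append:
  assumes "i < N"
  shows "live_count x i (\<theta>s @ \<theta>t) k = (\<Sum>(w, j)\<in>ancestors x i \<theta>s. live_count (coins_at w x) j \<theta>t k)"
proof -
  define C where "C = (\<lambda>(w, j). {v \<in> finite_words M (length \<theta>t). live (coins_at w x) v \<and> reach j \<theta>t v k})"
  define f where "f = (\<lambda>a. (@) (fst a) ` C a)"
  have "{w \<in> finite_words M (length (\<theta>s @ \<theta>t)). live x w \<and> reach i (\<theta>s @ \<theta>t) w k}
      = \<Union> (f ` ancestors x i \<theta>s)" (is "?l = ?r")
  proof
    show "?l \<subseteq> ?r"
    proof
      fix u assume u: "u \<in> ?l"
      define w v where "w = take (length \<theta>s) u" and "v = drop (length \<theta>s) u"
      have len: "length w = length \<theta>s" using u by (auto simp: w_def finite_words_def)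
      have uwv: "u = w @ v" by (simp add: w_def v_def)
      with u len assms obtain j where "j < N" "reach i \<theta>s w j" "reach j \<theta>t v k"
        by (auto simp: reach_append)
      moreover have "w \<in> finite_words M (length \<theta>s)" "v \<in> finite_words M (length \<theta>t)"
        using u uwv len append_in_finite_words[of w "length \<theta>s" v M "length \<theta>t"] by auto
      ultimately have "(w, j) \<in> ancestors x i \<theta>s" "v \<in> C (w, j)"
        using u uwv by (auto simp: ancestors_def C_def live_append)
      then show "u \<in> ?r" using uwv by (auto simp: f_def intro!: bexI[of _ "(w, j)"])
    qed
    show "?r \<subseteq> ?l"
      using assms by (auto simp: f_def C_def ancestors_def live_append append_in_finite_words
          length_finite_words reach_append)
  qed
  also have "card \<dots> = (\<Sum>a\<in>ancestors x i \<theta>s. card (f a))"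
  proof (intro card_UN_disjoint finite_ancestors ballI impI)
    fix a b assume ab: "a \<in> ancestors x i \<theta>s" "b \<in> ancestors x i \<theta>s" "a \<noteq> b"
    then have "fst a \<noteq> fst b" "length (fst a) = length (fst b)"
      using reach_determ by (auto simp: ancestors_def length_finite_words)
    then show "f a \<inter> f b = {}" by (auto simp: f_def)
  qed (auto simp: f_def C_def split: prod.splits)
  also have "\<dots> = (\<Sum>a\<in>ancestors x i \<theta>s. card (C a))"
    by (intro sum.cong refl) (simp add: f_def card_image inj_on_def)
  finally show ?thesis by (simp add: live_count_def C_def case_prod_beta)
qed

lemma sum_ancestors:
  fixes g :: "nat \<Rightarrow> real"
  shows "(\<Sum>(w, j)\<in>ancestors x i \<theta>s. g j) = (\<Sum>j<N. live_count x i \<theta>s j * g j)"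
proof -
  define C where "C j = {w \<in> finite_words M (length \<theta>s). live x w \<and> reach i \<theta>s w j}" for j
  have eq: "ancestors x i \<theta>s = (\<Union>j\<in>{..<N}. (\<lambda>w. (w, j)) ` C j)"
    by (auto simp: ancestors_def C_def)
  have "(\<Sum>(w, j)\<in>ancestors x i \<theta>s. g j) = (\<Sum>j<N. \<Sum>(w, j)\<in>(\<lambda>w. (w, j)) ` C j. g j)"
    unfolding eq by (intro sum.UNION_disjoint) (auto simp: C_def)
  also have "\<dots> = (\<Sum>j<N. real (card (C j)) * g j)"
    by (intro sum.cong refl) (simp add: sum.reindex inj_on_def)
  finally show ?thesis by (simp add: live_count_def C_def)
qed

lemma expectation_live_count: "coins.expectation p (\<lambda>\<omega>. live_count (coins_at w \<omega>) j \<theta>s k) = p ^ length \<theta>s * word_count \<theta>s j k"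
proof -
  define A where "A = {v \<in> finite_words M (length \<theta>s). reach j \<theta>s v k}"
  have finA: "finite A" by (simp add: A_def)
  have liveset: "{\<omega>. live \<omega> v} \<in> sets (coin_field p)" for v
  proof -
    have "{\<omega> \<in> space (coin_field p). \<forall>n<length v. \<omega> (take n v)} \<in> sets (coin_field p)" by measurable
    then show ?thesis by (simp add: live_def)
  qed
  have liveset': "{\<omega>. live (coins_at w \<omega>) v} \<in> sets (coin_field p)" for v
    using measurable_sets[OF measurable_coins_at[of w p] liveset[of v]] by (simp add: vimage_def)
  have "live_count (coins_at w \<omega>) j \<theta>s k = (\<Sum>v\<in>A. indicator {\<omega>. live (coins_at w \<omega>) v} \<omega>)" for \<omega>
  proof -
    have "(\<Sum>v\<in>A. indicator {\<omega>. live (coins_at w \<omega>) v} \<omega>) = real (card {v \<in> A. live (coins_at w \<omega>) v})"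
      using finA by (simp add: indicator_def sum.If_cases Int_def)
    then show ?thesis by (simp add: live_count_def A_def conj_ac)
  qed
  then have "coins.expectation p (\<lambda>\<omega>. live_count (coins_at w \<omega>) j \<theta>s k)
      = (\<Sum>v\<in>A. coins.expectation p (indicator {\<omega>. live (coins_at w \<omega>) v}))"
    using liveset' by (simp add: Bochner_Integration.integral_sum less_top[symmetric])
  also have "\<dots> = (\<Sum>v\<in>A. p ^ length \<theta>s)"
  proof (intro sum.cong refl)
    fix v assume "v \<in> A"
    then have "length v = length \<theta>s" by (auto simp: A_def finite_words_def)
    then show "coins.expectation p (indicator {\<omega>. live (coins_at w \<omega>) v}) = p ^ length \<theta>s"
      using liveset' measure_coins_at[OF liveset[of v], of w] prob_live[of p v] p_pos p_le by simp
  qed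
  finally show ?thesis by (simp add: word_count_def A_def)
qed

end

section \<open>Growth of the mass\<close>

text \<open>The hypotheses of the theorem in terms of counts, with rows \<open>u i\<close> of the matrix of the given vectors,
  initial state \<open>U\<close> and initial digit word \<open>\<theta>\<^sub>0\<close>.\<close>
locale covering_automaton = coin_automaton +
  fixes L :: nat and u :: "nat \<Rightarrow> nat \<Rightarrow> nat" and m S :: nat and \<gamma> :: real
    and U :: nat and \<theta>\<^sub>0 :: "nat list"
  assumes L_pos: "0 < L" and U_less: "U < N" and m_pos: "0 < m"
    and gamma: "1 < \<gamma>"
    and nonzero: "\<And>i. i < m \<Longrightarrow> \<exists>k<N. 0 < u i k"
    and growth: "\<And>\<theta>s. \<theta>s \<in> finite_words L S \<Longrightarrow> \<exists>A.
       (\<forall>i<m. \<forall>j<m. 0 \<le> A i j) \<and> (\<forall>i<m. \<gamma> \<le> (\<Sum>j<m. A i j)) \<and>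
       (\<forall>i<m. \<forall>k<N. (\<Sum>j<m. A i j * real (u j k)) \<le> (\<Sum>j<N. real (u i j) * (p ^ S * word_count \<theta>s j k)))"
    and start: "\<exists>i<m. \<forall>k<N. real (u i k) \<le> word_count \<theta>\<^sub>0 U k"
begin

lemma ex_word: "\<exists>\<theta>s. \<theta>s \<in> finite_words L n"
  using L_pos by (intro exI[of _ "replicate n 0"]) (auto simp: finite_words_def set_replicate_conv_if)

lemma sum_word_count_le: "i < N \<Longrightarrow> (\<Sum>k<N. word_count \<theta>s i k) \<le> real M ^ length \<theta>s"
proof -
  have "(\<Sum>k<N. card {w \<in> finite_words M (length \<theta>s). reach i \<theta>s w k})
     = card (\<Union>k<N. {w \<in> finite_words M (length \<theta>s). reach i \<theta>s w k})"
    by (intro card_UN_disjoint[symmetric]) (auto dest: reach_determ)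
  also have "\<dots> \<le> card (finite_words M (length \<theta>s))"
    by (intro card_mono) auto
  finally show ?thesis by (simp add: word_count_def card_finite_words flip: of_nat_sum of_nat_power)
qed

text \<open>All row sums of the count matrices are at most \<open>M ^ S\<close>. Compare the sums of the entries on both sides
  of the growth hypothesis for the vector \<open>u i\<close> with the smallest entry sum.\<close>
lemma supercritical: "1 < (p * real M) ^ S"
proof -
  obtain \<theta>s where \<theta>s: "\<theta>s \<in> finite_words L S" using ex_word by blast
  obtain A where A': "\<forall>i<m. \<forall>j<m. (0::real) \<le> A i j" "\<forall>i<m. \<gamma> \<le> (\<Sum>j<m. A i j)"
    "\<forall>i<m. \<forall>k<N. (\<Sum>j<m. A i j * real (u j k)) \<le> (\<Sum>j<N. real (u i j) * (p ^ S * word_count \<theta>s j k))"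
    using growth[OF \<theta>s] by (elim exE conjE) (rule that; assumption)
  note A = A'(1)[rule_format] A'(2)[rule_format] A'(3)[rule_format]
  define s where "s i = (\<Sum>k<N. real (u i k))" for i
  obtain i where i: "i < m" and min: "\<And>j. j < m \<Longrightarrow> s i \<le> s j"
  proof -
    have "Min (s ` {..<m}) \<in> s ` {..<m}" using m_pos by (intro Min_in) auto
    then obtain i where "i < m" "Min (s ` {..<m}) = s i" by auto
    moreover have "Min (s ` {..<m}) \<le> s j" if "j < m" for j using that by (intro Min_le) auto
    ultimately show ?thesis using that by simp
  qed
  have spos: "0 < s i"
  proof -
    obtain k where k: "k < N" "0 < u i k" using nonzero[OF i] by blast
    then have "real (u i k) \<le> s i" unfolding s_def by (intro member_le_sum) auto
    then show ?thesis using k by simp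
  qed
  have "\<gamma> * s i \<le> (\<Sum>j<m. A i j) * s i"
    using A(2)[OF i] spos by (intro mult_right_mono) auto
  also have "\<dots> \<le> (\<Sum>j<m. A i j * s j)"
    using min A(1)[OF i] by (auto simp: sum_distrib_right intro!: sum_mono mult_left_mono)
  also have "\<dots> = (\<Sum>k<N. \<Sum>j<m. A i j * real (u j k))"
    by (subst sum.swap) (simp add: s_def sum_distrib_left)
  also have "\<dots> \<le> (\<Sum>k<N. \<Sum>j<N. real (u i j) * (p ^ S * word_count \<theta>s j k))"
    using A(3)[OF i] by (intro sum_mono) auto
  also have "\<dots> = (\<Sum>j<N. real (u i j) * (p ^ S * (\<Sum>k<N. word_count \<theta>s j k)))"
    by (subst sum.swap) (simp add: sum_distrib_left)
  also have "\<dots> \<le> (\<Sum>j<N. real (u i j) * (p ^ S * real M ^ S))"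
    using sum_word_count_le[of _ \<theta>s] \<theta>s p_pos
    by (intro sum_mono mult_left_mono) (auto simp: length_finite_words)
  also have "\<dots> = (p * real M) ^ S * s i"
    by (simp add: s_def power_mult_distrib sum_distrib_left mult_ac)
  finally have "\<gamma> \<le> (p * real M) ^ S" using spos by simp
  then show ?thesis using gamma by simp
qed

lemma S_pos: "0 < S"
  using supercritical by (cases S) auto

lemma M_ge_2: "2 \<le> M"
proof (rule ccontr)
  assume "\<not> 2 \<le> M"
  then have "M = 0 \<or> M = 1" by auto
  then have "p * real M \<le> 1" "0 \<le> p * real M" using p_le p_pos by auto
  then have "(p * real M) ^ S \<le> 1" by (simp add: power_le_one)
  then show False using supercritical by simp
qed

text \<open>The combination may have real coefficients; only the vectors \<open>u i\<close> are integral.\<close>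
definition has_mass :: "real \<Rightarrow> (nat \<Rightarrow> real) \<Rightarrow> bool" where
  "has_mass R z \<longleftrightarrow> (\<exists>c. (\<forall>i<m. 0 \<le> c i) \<and> R \<le> (\<Sum>i<m. c i) \<and>
     (\<forall>k<N. (\<Sum>i<m. c i * real (u i k)) \<le> z k))"

lemma has_mass_mono: "has_mass R z \<Longrightarrow> R' \<le> R \<Longrightarrow> (\<And>k. k < N \<Longrightarrow> z k \<le> z' k) \<Longrightarrow> has_mass R' z'"
  unfolding has_mass_def by (meson order_trans)

lemma has_mass_scale:
  assumes "has_mass R z" "0 \<le> r"
  shows "has_mass (r * R) (\<lambda>k. r * z k)"
proof -
  obtain c where c: "\<forall>i<m. 0 \<le> c i" "R \<le> (\<Sum>i<m. c i)" "\<forall>k<N. (\<Sum>i<m. c i * real (u i k)) \<le> z k"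
    using assms unfolding has_mass_def by blast
  show ?thesis unfolding has_mass_def
    using c assms(2) by (intro exI[of _ "\<lambda>i. r * c i"])
      (auto simp: mult.assoc intro: mult_left_mono simp flip: sum_distrib_left)
qed

lemma has_mass_pos:
  assumes "has_mass R z" "0 < R"
  shows "\<exists>k<N. 0 < z k"
proof -
  obtain c where c: "\<forall>i<m. 0 \<le> c i" "R \<le> (\<Sum>i<m. c i)" "\<forall>k<N. (\<Sum>i<m. c i * real (u i k)) \<le> z k"
    using assms unfolding has_mass_def by blast
  have "\<exists>i<m. 0 < c i"
  proof (rule ccontr)
    assume "\<not> ?thesis"
    then have "(\<Sum>i<m. c i) \<le> 0" by (intro sum_nonpos) force
    then show False using c assms by simp
  qed
  then obtain i k where ik: "i < m" "0 < c i" "k < N" "0 < u i k" using nonzero by blast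
  have "0 < c i * real (u i k)" using ik by simp
  also have "\<dots> \<le> (\<Sum>i<m. c i * real (u i k))" using c ik by (intro member_le_sum) auto
  also have "\<dots> \<le> z k" using c ik by blast
  finally show ?thesis using ik by blast
qed

lemma has_mass_growth:
  assumes "has_mass R z" "\<theta>s \<in> finite_words L S"
  shows "has_mass (\<gamma> * R) (\<lambda>k. \<Sum>j<N. z j * (p ^ S * word_count \<theta>s j k))"
proof -
  obtain c where c: "\<forall>i<m. 0 \<le> c i" "R \<le> (\<Sum>i<m. c i)" "\<forall>k<N. (\<Sum>i<m. c i * real (u i k)) \<le> z k"
    using assms unfolding has_mass_def by blast
  obtain A where A': "\<forall>i<m. \<forall>j<m. (0::real) \<le> A i j" "\<forall>i<m. \<gamma> \<le> (\<Sum>j<m. A i j)"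
    "\<forall>i<m. \<forall>k<N. (\<Sum>j<m. A i j * real (u j k)) \<le> (\<Sum>j<N. real (u i j) * (p ^ S * word_count \<theta>s j k))"
    using growth[OF assms(2)] by (elim exE conjE) (rule that; assumption)
  note A = A'(1)[rule_format] A'(2)[rule_format] A'(3)[rule_format]
  have "\<gamma> * R \<le> \<gamma> * (\<Sum>i<m. c i)" using c gamma by (intro mult_left_mono) auto
  also have "\<dots> = (\<Sum>i<m. c i * \<gamma>)" by (simp add: sum_distrib_left mult.commute)
  also have "\<dots> \<le> (\<Sum>i<m. c i * (\<Sum>j<m. A i j))"
    using c A(2) by (intro sum_mono mult_left_mono) auto
  also have "\<dots> = (\<Sum>j<m. \<Sum>i<m. c i * A i j)"
    by (subst sum.swap) (simp add: sum_distrib_left)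
  finally have total: "\<gamma> * R \<le> (\<Sum>j<m. \<Sum>i<m. c i * A i j)" .
  have dom: "(\<Sum>j<m. (\<Sum>i<m. c i * A i j) * real (u j k)) \<le> (\<Sum>j<N. z j * (p ^ S * word_count \<theta>s j k))"
    if k: "k < N" for k
  proof -
    have "(\<Sum>j<m. (\<Sum>i<m. c i * A i j) * real (u j k)) = (\<Sum>i<m. c i * (\<Sum>j<m. A i j * real (u j k)))"
      unfolding sum_distrib_left sum_distrib_right by (subst sum.swap) (simp add: mult.assoc)
    also have "\<dots> \<le> (\<Sum>i<m. c i * (\<Sum>j<N. real (u i j) * (p ^ S * word_count \<theta>s j k)))"
      using c A(3) k by (intro sum_mono mult_left_mono) auto
    also have "\<dots> = (\<Sum>j<N. (\<Sum>i<m. c i * real (u i j)) * (p ^ S * word_count \<theta>s j k))"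
      unfolding sum_distrib_left sum_distrib_right by (subst sum.swap) (simp add: mult.assoc)
    also have "\<dots> \<le> (\<Sum>j<N. z j * (p ^ S * word_count \<theta>s j k))"
      using c p_pos by (intro sum_mono mult_right_mono) (auto simp: word_count_def)
    finally show ?thesis .
  qed
  show ?thesis unfolding has_mass_def
    using total dom c A(1) by (intro exI[of _ "\<lambda>j. \<Sum>i<m. c i * A i j"]) (auto intro!: sum_nonneg)
qed

text \<open>Drop all coefficients below \<open>\<epsilon> R / m\<close>. At most \<open>m\<close> of them are lost, so the total decreases by at most
  \<open>\<epsilon> R\<close>; and since the \<open>u i\<close> are integral, a remaining coefficient contributes at least its full
  size to every entry to which it contributes at all. Each nonzero entry is then large enough for a
  Chernoff bound.\<close>
lemma has_mass_threshold:
  assumes "has_mass R z" "0 < R" "0 < \<epsilon>"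
  shows "\<exists>a. has_mass ((1 - \<epsilon>) * R) a \<and> (\<forall>k<N. a k \<le> z k \<and> (a k = 0 \<or> \<epsilon> * R / real m \<le> a k))"
proof -
  obtain c where c: "\<forall>i<m. 0 \<le> c i" "R \<le> (\<Sum>i<m. c i)" "\<forall>k<N. (\<Sum>i<m. c i * real (u i k)) \<le> z k"
    using assms unfolding has_mass_def by blast
  define \<tau> where "\<tau> = \<epsilon> * R / real m"
  have tau: "0 < \<tau>" using assms m_pos by (simp add: \<tau>_def)
  define d where "d i = (if \<tau> \<le> c i then c i else 0)" for i
  have d: "0 \<le> d i" "d i \<le> c i" "c i - \<tau> \<le> d i" if "i < m" for i
    using c that tau by (auto simp: d_def)
  have "(1 - \<epsilon>) * R \<le> (\<Sum>i<m. c i) - real m * \<tau>"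
    using c m_pos by (simp add: \<tau>_def algebra_simps)
  also have "\<dots> = (\<Sum>i<m. c i - \<tau>)" by (simp add: sum_subtractf)
  also have "\<dots> \<le> (\<Sum>i<m. d i)" using d by (intro sum_mono) auto
  finally have total: "(1 - \<epsilon>) * R \<le> (\<Sum>i<m. d i)" .
  define a where "a k = (\<Sum>i<m. d i * real (u i k))" for k
  have "has_mass ((1 - \<epsilon>) * R) a"
    unfolding has_mass_def using total d by (intro exI[of _ d]) (auto simp: a_def)
  moreover have "a k \<le> z k" if "k < N" for k
  proof -
    have "a k \<le> (\<Sum>i<m. c i * real (u i k))"
      unfolding a_def using d by (intro sum_mono mult_right_mono) auto
    then show ?thesis using c that by fastforce
  qed
  moreover have "a k = 0 \<or> \<tau> \<le> a k" for k
  proof (cases "\<exists>i<m. \<tau> \<le> c i \<and> 0 < u i k")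
    case True
    then obtain i where i: "i < m" "\<tau> \<le> c i" "0 < u i k" by blast
    then have "\<tau> * 1 \<le> d i * real (u i k)"
      using tau unfolding d_def by (intro mult_mono) auto
    also have "\<dots> \<le> a k" unfolding a_def using i d by (intro member_le_sum) auto
    finally show ?thesis by simp
  next
    case False
    then have "a k = 0" unfolding a_def d_def by (intro sum.neutral) auto
    then show ?thesis ..
  qed
  ultimately show ?thesis unfolding \<tau>_def by blast
qed

text \<open>The nodes whose coins decide which words of length \<open>h\<close> are live.\<close>
definition shallow :: "nat \<Rightarrow> nat list set" where
  "shallow h = {w. length w < h \<and> set w \<subseteq> {..<M}}"

lemma finite_shallow: "finite (shallow h)"
  by (rule finite_subset[OF _ finite_lists_length_le[of "{..<M}" h]]) (auto simp: shallow_def)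

lemma shallow_mono: "h \<le> h' \<Longrightarrow> shallow h \<subseteq> shallow h'"
  by (auto simp: shallow_def)

lemma depends_on_live_count: "depends_on (shallow (length \<theta>s)) (\<lambda>x. live_count x i \<theta>s k)"
  unfolding depends_on_def by (auto simp: shallow_def intro!: live_count_cong)

lemma depends_on_has_mass:
  assumes "length \<theta>s \<le> h"
  shows "depends_on (shallow h) (\<lambda>x. has_mass R (live_count x i \<theta>s))"
  unfolding depends_on_def
proof (intro allI impI)
  fix x y :: "nat list \<Rightarrow> bool" assume xy: "\<forall>v\<in>shallow h. x v = y v"
  have "live_count x i \<theta>s k = live_count y i \<theta>s k" for k
    using xy shallow_mono[OF assms] by (intro depends_onD[OF depends_on_live_count]) auto
  then show "has_mass R (live_count x i \<theta>s) = has_mass R (live_count y i \<theta>s)" by presburger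
qed

text \<open>The live words of a given length are tested at shallow nodes, while the offspring of an ancestor
  \<open>w\<close> is tested at nodes from \<open>w\<close> downwards. Distinct ancestors have the same length, so the
  regions below them are disjoint.\<close>
lemma indep_ancestors:
  assumes i: "i < N"
  shows "coins.indep_vars p (\<lambda>_. borel)
     (case_option (indicator {\<omega>. \<forall>v\<in>shallow (length \<theta>s). \<omega> v = \<sigma> v})
        (\<lambda>(w, j) \<omega>. live_count (coins_at w \<omega>) j \<theta>t k))
     (insert None (Some ` ancestors \<sigma> i \<theta>s))"
proof (rule indep_vars_depends_on)
  define K where "K q = (case q of None \<Rightarrow> shallow (length \<theta>s)
     | Some (w, j) \<Rightarrow> (@) w ` shallow (length \<theta>t))" for q :: "(nat list \<times> nat) option"
  show "disjoint_family_on K (insert None (Some ` ancestors \<sigma> i \<theta>s))"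
    unfolding disjoint_family_on_def
  proof (intro ballI impI)
    fix q q' assume q: "q \<in> insert None (Some ` ancestors \<sigma> i \<theta>s)" "q' \<in> insert None (Some ` ancestors \<sigma> i \<theta>s)"
      and ne: "q \<noteq> q'"
    have 1: "shallow (length \<theta>s) \<inter> (@) w ` shallow (length \<theta>t) = {}" if "(w, j) \<in> ancestors \<sigma> i \<theta>s" for w j
      using that by (auto simp: ancestors_def finite_words_def shallow_def)
    have 2: "w \<noteq> w' \<and> length w = length w'"
      if "(w, j) \<in> ancestors \<sigma> i \<theta>s" "(w', j') \<in> ancestors \<sigma> i \<theta>s" "(w, j) \<noteq> (w', j')" for w j w' j'
      using that reach_determ by (auto simp: ancestors_def finite_words_def)
    show "K q \<inter> K q' = {}"
    proof (cases q)
      case None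
      then show ?thesis using q ne 1 by (cases q') (auto simp: K_def split: prod.splits)
    next
      case q: (Some a)
      show ?thesis
      proof (cases q')
        case None
        then show ?thesis using q \<open>q \<in> _\<close> 1 by (auto simp: K_def split: prod.splits)
      next
        case q': (Some b)
        have "fst a \<noteq> fst b \<and> length (fst a) = length (fst b)"
          using q q' \<open>q \<in> _\<close> \<open>q' \<in> _\<close> ne 2[of "fst a" "snd a" "fst b" "snd b"] by auto
        then show ?thesis using q q' by (auto simp: K_def split: prod.splits)
      qed
    qed
  qed
  fix q assume q: "q \<in> insert None (Some ` ancestors \<sigma> i \<theta>s)"
  show dep: "depends_on (K q) (case_option (indicator {\<omega>. \<forall>v\<in>shallow (length \<theta>s). \<omega> v = \<sigma> v})
        (\<lambda>(w, j) \<omega>. live_count (coins_at w \<omega>) j \<theta>t k) q :: _ \<Rightarrow> real)"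
  proof (cases q)
    case None
    then show ?thesis by (auto simp: depends_on_def K_def indicator_def)
  next
    case (Some wj)
    obtain w j where wj: "wj = (w, j)" by force
    show ?thesis unfolding depends_on_def Some wj option.case prod.case
    proof (intro allI impI)
      fix x y :: "nat list \<Rightarrow> bool" assume xy: "\<forall>v\<in>K (Some (w, j)). x v = y v"
      show "live_count (coins_at w x) j \<theta>t k = live_count (coins_at w y) j \<theta>t k"
        using xy by (intro depends_onD[OF depends_on_live_count]) (auto simp: coins_at_def K_def)
    qed
  qed
  have "finite (K q)" by (cases q) (auto simp: K_def finite_shallow)
  then show "case_option (indicator {\<omega>. \<forall>v\<in>shallow (length \<theta>s). \<omega> v = \<sigma> v})
        (\<lambda>(w, j) \<omega>. live_count (coins_at w \<omega>) j \<theta>t k) q \<in> coin_field p \<rightarrow>\<^sub>M (borel :: real measure)"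
    using dep by (intro measurable_depends_on[of "K q"]) auto
qed

text \<open>One step of the growth, conditioned on all earlier coins. The expected offspring has mass \<open>\<gamma> R\<close>;
  thresholding and the Chernoff bound each cost a factor \<open>1 - \<epsilon>\<close>. Each of the \<open>N\<close> types is treated
  separately, which gives the factor \<open>N\<close>.\<close>
lemma concentration:
  assumes i: "i < N" and g: "has_mass R (live_count \<sigma> i \<theta>s)" and R: "0 < R"
    and \<theta>t: "\<theta>t \<in> finite_words L S" and eps: "0 < \<epsilon>" "\<epsilon> < 1"
  shows "coins.prob p ({\<omega>. \<forall>v\<in>shallow (length \<theta>s). \<omega> v = \<sigma> v}
        \<inter> {\<omega>. \<not> has_mass ((1 - \<epsilon>)\<^sup>2 * \<gamma> * R) (live_count \<omega> i (\<theta>s @ \<theta>t))})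
    \<le> coins.prob p {\<omega>. \<forall>v\<in>shallow (length \<theta>s). \<omega> v = \<sigma> v}
        * (real N * exp (- (\<epsilon> ^ 3 * \<gamma> * R / (4 * real m * real M ^ S))))"
    (is "coins.prob p (?D \<inter> ?bad) \<le> coins.prob p ?D * (real N * exp (- ?r))")
proof -
  define mean where "mean k = (\<Sum>j<N. live_count \<sigma> i \<theta>s j * (p ^ S * word_count \<theta>t j k))" for k
  have gR: "0 < \<gamma> * R" using gamma R by simp
  obtain a where a: "has_mass ((1 - \<epsilon>) * (\<gamma> * R)) a" "\<And>k. k < N \<Longrightarrow> a k \<le> mean k"
    "\<And>k. k < N \<Longrightarrow> a k = 0 \<or> \<epsilon> * (\<gamma> * R) / real m \<le> a k"
    using has_mass_threshold[OF has_mass_growth[OF g \<theta>t] gR eps(1)] unfolding mean_def by auto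
  have D: "?D \<in> sets (coin_field p)"
    using measurable_depends_on[of "shallow (length \<theta>s)" "\<lambda>\<omega>. \<forall>v\<in>shallow (length \<theta>s). \<omega> v = \<sigma> v" "count_space UNIV" p]
    by (auto simp: finite_shallow depends_on_def pred_def)
  have MS: "0 < real M ^ S" using M_ge_2 by simp
  define low where "low k = {\<omega>. (\<Sum>(w, j)\<in>ancestors \<sigma> i \<theta>s. live_count (coins_at w \<omega>) j \<theta>t k) < (1 - \<epsilon>) * a k}" for k
  have one: "coins.prob p (?D \<inter> low k) \<le> coins.prob p ?D * exp (- ?r) \<and> low k \<in> sets (coin_field p)" if k: "k < N" for k
  proof (cases "a k = 0")
    case True
    \<comment> \<open>a type that is not required cannot fall short\<close>
    have "0 \<le> (\<Sum>(w, j)\<in>ancestors \<sigma> i \<theta>s. live_count (coins_at w \<omega>) j \<theta>t k)" for \<omega>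
      by (intro sum_nonneg) (auto simp: live_count_nonneg)
    then have "low k = {}" using True by (auto simp: low_def not_less)
    then show ?thesis by simp
  next
    case False
    then have ak: "\<epsilon> * (\<gamma> * R) / real m \<le> a k" using a(3)[OF k] by simp
    have "0 < \<epsilon> * (\<gamma> * R) / real m" using eps gR m_pos by simp
    then have ak0: "0 \<le> a k" using ak by simp
    have ind: "coins.indep_vars p (\<lambda>_. borel)
       (case_option (indicator ?D) (\<lambda>(w, j) \<omega>. live_count (coins_at w \<omega>) j \<theta>t k))
       (insert None (Some ` ancestors \<sigma> i \<theta>s))"
      by (rule indep_ancestors[OF i])
    have len: "length \<theta>t = S" using \<theta>t by (rule length_finite_words)
    have mean: "(\<Sum>q\<in>ancestors \<sigma> i \<theta>s. coins.expectation p ((\<lambda>(w, j) \<omega>. live_count (coins_at w \<omega>) j \<theta>t k) q)) = mean k"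
    proof -
      have "(\<Sum>q\<in>ancestors \<sigma> i \<theta>s. coins.expectation p ((\<lambda>(w, j) \<omega>. live_count (coins_at w \<omega>) j \<theta>t k) q))
          = (\<Sum>(w, j)\<in>ancestors \<sigma> i \<theta>s. p ^ S * word_count \<theta>t j k)"
        by (intro sum.cong refl) (auto simp: expectation_live_count len)
      then show ?thesis by (simp add: sum_ancestors mean_def)
    qed
    have "coins.prob p (?D \<inter> {\<omega> \<in> space (coin_field p).
         (\<Sum>q\<in>ancestors \<sigma> i \<theta>s. (\<lambda>(w, j) \<omega>. live_count (coins_at w \<omega>) j \<theta>t k) q \<omega>) < (1 - \<epsilon>) * a k})
       \<le> coins.prob p ?D * exp (- (\<epsilon>\<^sup>2 * a k / (4 * real M ^ S)))"
      using live_count_le[of _ _ \<theta>t] a(2)[OF k] ak0 eps MS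
      by (intro coins.chernoff_lower_tail[OF finite_ancestors ind D]) (auto simp: live_count_nonneg len mean)
    also have "{\<omega> \<in> space (coin_field p).
         (\<Sum>q\<in>ancestors \<sigma> i \<theta>s. (\<lambda>(w, j) \<omega>. live_count (coins_at w \<omega>) j \<theta>t k) q \<omega>) < (1 - \<epsilon>) * a k} = low k"
      by (auto simp: low_def case_prod_beta)
    finally have 1: "coins.prob p (?D \<inter> low k) \<le> coins.prob p ?D * exp (- (\<epsilon>\<^sup>2 * a k / (4 * real M ^ S)))" .
    have "?r = \<epsilon>\<^sup>2 * (\<epsilon> * (\<gamma> * R) / real m) / (4 * real M ^ S)"
      by (simp add: power2_eq_square power3_eq_cube)
    also have "\<dots> \<le> \<epsilon>\<^sup>2 * a k / (4 * real M ^ S)"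
      using ak MS by (intro divide_right_mono mult_left_mono) auto
    finally have "coins.prob p ?D * exp (- (\<epsilon>\<^sup>2 * a k / (4 * real M ^ S))) \<le> coins.prob p ?D * exp (- ?r)"
      by (intro mult_left_mono) auto
    moreover have "low k \<in> sets (coin_field p)"
    proof -
      have "(\<lambda>\<omega>. live_count (coins_at w \<omega>) j \<theta>t k) \<in> coin_field p \<rightarrow>\<^sub>M borel" for w j
        using measurable_compose[OF measurable_coins_at measurable_depends_on[OF depends_on_live_count finite_shallow]] by simp
      then have "(\<lambda>\<omega>. \<Sum>(w, j)\<in>ancestors \<sigma> i \<theta>s. live_count (coins_at w \<omega>) j \<theta>t k) \<in> coin_field p \<rightarrow>\<^sub>M borel"
        by (intro borel_measurable_sum) (auto split: prod.splits)
      then have "{\<omega> \<in> space (coin_field p). (\<Sum>(w, j)\<in>ancestors \<sigma> i \<theta>s. live_count (coins_at w \<omega>) j \<theta>t k) < (1 - \<epsilon>) * a k}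
          \<in> sets (coin_field p)" by measurable
      then show ?thesis by (simp add: low_def)
    qed
    ultimately show ?thesis using 1 by linarith
  qed
  have sub: "?D \<inter> ?bad \<subseteq> (\<Union>k<N. ?D \<inter> low k)"
  proof
    fix \<omega> assume \<omega>: "\<omega> \<in> ?D \<inter> ?bad"
    have "ancestors \<omega> i \<theta>s = ancestors \<sigma> i \<theta>s"
    proof -
      have "live \<omega> w = live \<sigma> w" if "w \<in> finite_words M (length \<theta>s)" for w
      proof (rule live_cong)
        fix n assume "n < length w"
        then have "take n w \<in> shallow (length \<theta>s)"
          using that by (auto simp: shallow_def finite_words_def dest: in_set_takeD)
        then show "\<omega> (take n w) = \<sigma> (take n w)" using \<omega> by auto
      qed
      then show ?thesis unfolding ancestors_def by blast
    qed
    then have Zsum: "live_count \<omega> i (\<theta>s @ \<theta>t) k = (\<Sum>(w, j)\<in>ancestors \<sigma> i \<theta>s. live_count (coins_at w \<omega>) j \<theta>t k)" for k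
      by (simp add: live_count_append[OF i])
    have "\<exists>k<N. \<omega> \<in> low k"
    proof (rule ccontr)
      assume "\<not> ?thesis"
      then have "\<omega> \<notin> low k" if "k < N" for k using that by blast
      then have "(1 - \<epsilon>) * a k \<le> live_count \<omega> i (\<theta>s @ \<theta>t) k" if "k < N" for k
        using that by (simp add: low_def Zsum not_less)
      then have "has_mass ((1 - \<epsilon>)\<^sup>2 * \<gamma> * R) (live_count \<omega> i (\<theta>s @ \<theta>t))"
        using eps by (intro has_mass_mono[OF has_mass_scale[OF a(1), of "1 - \<epsilon>"]]) (auto simp: power2_eq_square mult.assoc)
      then show False using \<omega> by auto
    qed
    then show "\<omega> \<in> (\<Union>k<N. ?D \<inter> low k)" using \<omega> by auto
  qed
  have "coins.prob p (?D \<inter> ?bad) \<le> coins.prob p (\<Union>k<N. ?D \<inter> low k)"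
    using one D by (intro coins.finite_measure_mono sub sets.finite_UN) auto
  also have "\<dots> \<le> (\<Sum>k<N. coins.prob p (?D \<inter> low k))"
    using one D by (intro coins.finite_measure_subadditive_finite) auto
  also have "\<dots> \<le> (\<Sum>k<N. coins.prob p ?D * exp (- ?r))"
    using one by (intro sum_mono) auto
  also have "\<dots> = coins.prob p ?D * (real N * exp (- ?r))"
    by simp
  finally show ?thesis .
qed

end

section \<open>Growth at all stages with positive probability\<close>

lemma power_over_fact_le_exp:
  fixes y :: real
  assumes "0 \<le> y"
  shows "y ^ n / fact n \<le> exp y"
proof -
  have "(\<Sum>k\<in>{n}. y ^ k /\<^sub>R fact k) \<le> exp y"
    unfolding exp_def using assms by (intro sum_le_suminf summable_exp_generic) auto
  then show ?thesis by (simp add: divide_inverse mult.commute)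
qed

text \<open>With \<open>\<rho> ^ K > 2 c\<close>, the bound \<open>exp (- y) \<le> K! / y ^ K\<close> at \<open>y = \<delta> \<rho> ^ n\<close> leaves a geometric
  series of ratio at most one half.\<close>
lemma summable_power_times_double_exp:
  fixes c \<delta> \<rho> :: real
  assumes c: "0 < c" and d: "0 < \<delta>" and r: "1 < \<rho>"
  shows "summable (\<lambda>n. c ^ n * exp (- (\<delta> * \<rho> ^ n)))"
proof -
  obtain K where K: "2 * c < \<rho> ^ K" using real_arch_pow[OF r] by blast
  have "norm (c ^ n * exp (- (\<delta> * \<rho> ^ n))) \<le> fact K / \<delta> ^ K * (1 / 2) ^ n" for n
  proof -
    have y: "0 < \<delta> * \<rho> ^ n" using d r by simp
    have "exp (- (\<delta> * \<rho> ^ n)) \<le> fact K / (\<delta> * \<rho> ^ n) ^ K"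
      using le_imp_inverse_le[OF power_over_fact_le_exp[of "\<delta> * \<rho> ^ n" K]] y
      by (simp only: exp_minus inverse_divide) simp
    then have "c ^ n * exp (- (\<delta> * \<rho> ^ n)) \<le> c ^ n * (fact K / (\<delta> * \<rho> ^ n) ^ K)"
      using c by (intro mult_left_mono) auto
    also have "\<dots> = fact K / \<delta> ^ K * (c / \<rho> ^ K) ^ n"
      by (simp add: power_mult_distrib power_divide mult.commute flip: power_mult)
    also have "\<dots> \<le> fact K / \<delta> ^ K * (1 / 2) ^ n"
      using K c d r by (intro mult_left_mono power_mono) (auto simp: field_simps)
    finally show ?thesis using c by simp
  qed
  moreover have "summable (\<lambda>n. fact K / \<delta> ^ K * (1 / 2) ^ n)"
    by (intro summable_mult summable_geometric) simp
  ultimately show ?thesis by (rule summable_comparison_test'[rotated])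
qed

context covering_automaton
begin

lemma word_count_append: "i < N \<Longrightarrow> word_count (\<theta>s @ \<theta>t) i k = (\<Sum>j<N. word_count \<theta>s i j * word_count \<theta>t j k)"
  using live_count_append[where x="\<lambda>_. True" and i=i and \<theta>s=\<theta>s and \<theta>t=\<theta>t and k=k]
    sum_ancestors[where x="\<lambda>_. True" and g="\<lambda>j. word_count \<theta>t j k" and i=i and \<theta>s=\<theta>s]
  by (simp add: live_count_eq_word_count coins_at_def case_prod_beta)

text \<open>Growth of the deterministic counts; they dominate the means because \<open>p ^ S \<le> 1\<close>.\<close>
lemma has_mass_word_count: "\<theta>s \<in> finite_words L (n * S) \<Longrightarrow> has_mass (\<gamma> ^ n) (word_count (\<theta>\<^sub>0 @ \<theta>s) U)"
proof (induction n arbitrary: \<theta>s)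
  case 0
  obtain i where i: "i < m" "\<forall>k<N. real (u i k) \<le> word_count \<theta>\<^sub>0 U k" using start by blast
  have "(\<Sum>j<m. (if j = i then 1 else 0) * real (u j k)) = real (u i k)" for k
    using i by (simp add: if_distrib[of "\<lambda>x. x * _"] cong: if_cong)
  then show ?case
    unfolding has_mass_def using i 0 by (intro exI[of _ "\<lambda>j. if j = i then 1 else 0"]) auto
next
  case (Suc n)
  define \<theta>a \<theta>t where "\<theta>a = take (n * S) \<theta>s" and "\<theta>t = drop (n * S) \<theta>s"
  have a: "\<theta>a \<in> finite_words L (n * S)" and t: "\<theta>t \<in> finite_words L S"
    using take_in_finite_words[OF Suc.prems, of "n * S"] drop_in_finite_words[OF Suc.prems, of "n * S"]
    by (auto simp: \<theta>a_def \<theta>t_def)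
  have s: "\<theta>\<^sub>0 @ \<theta>s = (\<theta>\<^sub>0 @ \<theta>a) @ \<theta>t" by (simp add: \<theta>a_def \<theta>t_def)
  show ?case
  proof (rule has_mass_mono[OF has_mass_growth[OF Suc.IH[OF a] t]])
    fix k
    have "p ^ S \<le> 1" using p_pos p_le by (simp add: power_le_one)
    then have "(\<Sum>j<N. word_count (\<theta>\<^sub>0 @ \<theta>a) U j * (p ^ S * word_count \<theta>t j k)) \<le> (\<Sum>j<N. word_count (\<theta>\<^sub>0 @ \<theta>a) U j * (1 * word_count \<theta>t j k))"
      by (intro sum_mono mult_left_mono mult_right_mono) (auto simp: word_count_def)
    then show "(\<Sum>j<N. word_count (\<theta>\<^sub>0 @ \<theta>a) U j * (p ^ S * word_count \<theta>t j k)) \<le> word_count (\<theta>\<^sub>0 @ \<theta>s) U k"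
      unfolding s word_count_append[OF U_less, of "\<theta>\<^sub>0 @ \<theta>a" \<theta>t] by simp
  qed simp
qed

text \<open>Any \<open>\<rho>\<close> strictly between 1 and \<open>\<gamma>\<close> would do as the growth factor, with \<open>\<epsilon>\<close> so small that two
  losses of the factor \<open>1 - \<epsilon>\<close> still leave \<open>\<rho>\<close>. The constant \<open>\<delta>\<close> is the
  exponential rate per unit of mass in \<open>concentration\<close>.\<close>
definition \<rho> :: real where "\<rho> = (1 + \<gamma>) / 2"
definition \<epsilon> :: real where "\<epsilon> = (\<gamma> - 1) / (4 * \<gamma>)"
definition \<delta> :: real where "\<delta> = \<epsilon> ^ 3 * \<gamma> / (4 * real m * real M ^ S)"

lemma rho: "1 < \<rho>" "\<rho> \<le> \<gamma>"
  using gamma by (auto simp: \<rho>_def)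

lemma eps: "0 < \<epsilon>" "\<epsilon> < 1" "\<rho> \<le> (1 - \<epsilon>)\<^sup>2 * \<gamma>"
proof -
  show "0 < \<epsilon>" "\<epsilon> < 1" using gamma by (auto simp: \<epsilon>_def field_simps)
  have "\<rho> = (1 - 2 * \<epsilon>) * \<gamma>" using gamma by (simp add: \<rho>_def \<epsilon>_def field_simps)
  also have "\<dots> \<le> (1 - \<epsilon>)\<^sup>2 * \<gamma>"
    using gamma by (intro mult_right_mono) (auto simp: power2_eq_square algebra_simps)
  finally show "\<rho> \<le> (1 - \<epsilon>)\<^sup>2 * \<gamma>" .
qed

lemma delta_pos: "0 < \<delta>"
  using eps gamma m_pos M_ge_2 by (simp add: \<delta>_def)

text \<open>Stage \<open>n\<close> is decided by the coins of depth below \<open>depth n\<close>.\<close>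
definition depth :: "nat \<Rightarrow> nat" where "depth n = length \<theta>\<^sub>0 + n * S"

definition stage :: "nat \<Rightarrow> (nat list \<Rightarrow> bool) \<Rightarrow> bool" where
  "stage n \<omega> \<longleftrightarrow> (\<forall>\<theta>s\<in>finite_words L (n * S). has_mass (\<rho> ^ n) (live_count \<omega> U (\<theta>\<^sub>0 @ \<theta>s)))"

definition err :: "nat \<Rightarrow> real" where
  "err n = real L ^ (Suc n * S) * (real N * exp (- (\<delta> * \<rho> ^ n)))"

lemma err_nonneg: "0 \<le> err n"
  by (simp add: err_def)

lemma depends_on_stage: "n \<le> n' \<Longrightarrow> depends_on (shallow (depth n')) (stage n)"
  unfolding depends_on_def stage_def
proof (intro allI impI ball_cong refl)
  fix x y :: "nat list \<Rightarrow> bool" and \<theta>s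
  assume le: "n \<le> n'" and xy: "\<forall>v\<in>shallow (depth n'). x v = y v" and \<theta>s: "\<theta>s \<in> finite_words L (n * S)"
  have "length (\<theta>\<^sub>0 @ \<theta>s) \<le> depth n'"
    using le \<theta>s by (simp add: depth_def length_finite_words)
  from depends_onD[OF depends_on_has_mass[OF this], of x y] xy
  show "has_mass (\<rho> ^ n) (live_count x U (\<theta>\<^sub>0 @ \<theta>s)) = has_mass (\<rho> ^ n) (live_count y U (\<theta>\<^sub>0 @ \<theta>s))" by blast
qed

lemma sets_stage: "{\<omega>. stage n \<omega>} \<in> sets (coin_field p)"
  using depends_on_stage[of n n] by (rule sets_depends_on[OF _ finite_shallow]) simp

lemma sets_not_stage: "{\<omega>. \<not> stage n \<omega>} \<in> sets (coin_field p)"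
  using sets.compl_sets[OF sets_stage[of n]] by (simp add: Collect_neg_eq Compl_eq_Diff_UNIV)

lemma stage_if_all_live:
  assumes "\<forall>v\<in>shallow (depth n). \<omega> v"
  shows "stage n \<omega>"
  unfolding stage_def
proof
  fix \<theta>s assume \<theta>s: "\<theta>s \<in> finite_words L (n * S)"
  have "live_count \<omega> U (\<theta>\<^sub>0 @ \<theta>s) k = word_count (\<theta>\<^sub>0 @ \<theta>s) U k" for k
    using assms \<theta>s by (intro live_count_eq_word_count) (auto simp: shallow_def depth_def length_finite_words)
  moreover have "\<rho> ^ n \<le> \<gamma> ^ n" using rho by (intro power_mono) auto
  ultimately show "has_mass (\<rho> ^ n) (live_count \<omega> U (\<theta>\<^sub>0 @ \<theta>s))"
    by (intro has_mass_mono[OF has_mass_word_count[OF \<theta>s]]) auto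
qed

text \<open>Union bound over the \<open>L ^ (Suc n * S)\<close> digit words of the next stage.\<close>
lemma prob_stage_step:
  assumes dep: "depends_on (shallow (depth n)) \<Phi>" and st: "\<And>\<omega>. \<Phi> \<omega> \<Longrightarrow> stage n \<omega>"
  shows "coins.prob p ({\<omega>. \<Phi> \<omega>} \<inter> {\<omega>. \<not> stage (Suc n) \<omega>}) \<le> coins.prob p {\<omega>. \<Phi> \<omega>} * err n"
proof (rule prob_conditional_le[OF finite_shallow dep sets_not_stage])
  fix \<sigma> assume "\<Phi> \<sigma>"
  then have st: "stage n \<sigma>" by (rule st)
  define D where "D = {\<omega>. \<forall>v\<in>shallow (depth n). \<omega> v = \<sigma> v}"
  define F where "F = finite_words L (Suc n * S)"
  define bad where "bad \<theta>s = {\<omega>. \<not> has_mass ((1 - \<epsilon>)\<^sup>2 * \<gamma> * \<rho> ^ n) (live_count \<omega> U (\<theta>\<^sub>0 @ \<theta>s))}" for \<theta>s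
  have D: "D \<in> sets (coin_field p)"
    unfolding D_def by (intro sets_depends_on[OF _ finite_shallow]) (auto simp: depends_on_def)
  have bad: "bad \<theta>s \<in> sets (coin_field p)" for \<theta>s
    unfolding bad_def using depends_on_has_mass[of "\<theta>\<^sub>0 @ \<theta>s", OF order_refl]
    by (intro sets_depends_on[OF _ finite_shallow]) (auto simp: depends_on_def)
  have "D \<inter> {\<omega>. \<not> stage (Suc n) \<omega>} \<subseteq> (\<Union>\<theta>s\<in>F. D \<inter> bad \<theta>s)"
  proof
    fix \<omega> assume \<omega>: "\<omega> \<in> D \<inter> {\<omega>. \<not> stage (Suc n) \<omega>}"
    then obtain \<theta>s where "\<theta>s \<in> F" "\<not> has_mass (\<rho> ^ Suc n) (live_count \<omega> U (\<theta>\<^sub>0 @ \<theta>s))"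
      by (auto simp: stage_def F_def)
    moreover have "\<rho> ^ Suc n \<le> (1 - \<epsilon>)\<^sup>2 * \<gamma> * \<rho> ^ n"
      using eps rho by (simp add: mult_right_mono)
    ultimately show "\<omega> \<in> (\<Union>\<theta>s\<in>F. D \<inter> bad \<theta>s)"
      using \<omega> by (auto simp: bad_def intro: has_mass_mono)
  qed
  then have "coins.prob p (D \<inter> {\<omega>. \<not> stage (Suc n) \<omega>}) \<le> coins.prob p (\<Union>\<theta>s\<in>F. D \<inter> bad \<theta>s)"
    using D bad by (intro coins.finite_measure_mono sets.finite_UN) (auto simp: F_def)
  also have "\<dots> \<le> (\<Sum>\<theta>s\<in>F. coins.prob p (D \<inter> bad \<theta>s))"
    using D bad by (intro coins.finite_measure_subadditive_finite) (auto simp: F_def)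
  also have "\<dots> \<le> (\<Sum>\<theta>s\<in>F. coins.prob p D * (real N * exp (- (\<delta> * \<rho> ^ n))))"
  proof (rule sum_mono)
    fix \<theta>s assume \<theta>s: "\<theta>s \<in> F"
    define \<theta>a \<theta>t where "\<theta>a = take (n * S) \<theta>s" and "\<theta>t = drop (n * S) \<theta>s"
    have a: "\<theta>a \<in> finite_words L (n * S)" and t: "\<theta>t \<in> finite_words L S"
      using take_in_finite_words[of \<theta>s L "Suc n * S" "n * S"] drop_in_finite_words[of \<theta>s L "Suc n * S" "n * S"] \<theta>s
      by (auto simp: \<theta>a_def \<theta>t_def F_def)
    have s: "\<theta>\<^sub>0 @ \<theta>s = (\<theta>\<^sub>0 @ \<theta>a) @ \<theta>t" by (simp add: \<theta>a_def \<theta>t_def)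
    have len: "length (\<theta>\<^sub>0 @ \<theta>a) = depth n" using a by (simp add: depth_def length_finite_words)
    have g: "has_mass (\<rho> ^ n) (live_count \<sigma> U (\<theta>\<^sub>0 @ \<theta>a))" using st a by (simp add: stage_def)
    have "coins.prob p (D \<inter> bad \<theta>s) \<le> coins.prob p D
        * (real N * exp (- (\<epsilon> ^ 3 * \<gamma> * \<rho> ^ n / (4 * real m * real M ^ S))))"
      using concentration[OF U_less g _ t eps(1,2)] rho(1)
      unfolding len D_def bad_def s by simp
    then show "coins.prob p (D \<inter> bad \<theta>s) \<le> coins.prob p D * (real N * exp (- (\<delta> * \<rho> ^ n)))"
      by (simp add: \<delta>_def)
  qed
  also have "\<dots> = coins.prob p D * err n"
    by (simp add: err_def F_def card_finite_words)
  finally show "coins.prob p ({\<omega>. \<forall>v\<in>shallow (depth n). \<omega> v = \<sigma> v} \<inter> {\<omega>. \<not> stage (Suc n) \<omega>})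
      \<le> coins.prob p {\<omega>. \<forall>v\<in>shallow (depth n). \<omega> v = \<sigma> v} * err n"
    by (simp add: D_def)
qed

lemma summable_err: "summable err"
proof -
  have "summable (\<lambda>n. real L ^ S * real N * ((real L ^ S) ^ n * exp (- (\<delta> * \<rho> ^ n))))"
    using L_pos delta_pos rho by (intro summable_mult summable_power_times_double_exp) auto
  also have "(\<lambda>n. real L ^ S * real N * ((real L ^ S) ^ n * exp (- (\<delta> * \<rho> ^ n)))) = err"
    by (auto simp: err_def fun_eq_iff power_add mult_ac simp flip: power_mult)
  finally show ?thesis .
qed

text \<open>Start at a stage \<open>n\<^sub>0\<close> beyond which the errors sum to at most one half. Stage \<open>n\<^sub>0\<close> itself has positive
  probability since it holds when all shallow coins succeed, and at least half of that probability
  remains when all later stages are required as well.\<close>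
lemma prob_all_stages_pos: "\<exists>n\<^sub>0. 0 < coins.prob p {\<omega>. \<forall>n\<ge>n\<^sub>0. stage n \<omega>}"
proof -
  obtain n0 where n0: "norm (\<Sum>i. err (i + n0)) < 1 / 2"
    using suminf_exist_split[OF _ summable_err, of "1 / 2"] by auto
  have tail: "(\<Sum>i<n. err (n0 + i)) \<le> 1 / 2" for n
  proof -
    have "(\<Sum>i<n. err (i + n0)) \<le> (\<Sum>i. err (i + n0))"
      using err_nonneg summable_err by (intro sum_le_suminf) (auto simp: summable_iff_shift)
    then show ?thesis using n0 by (simp add: add.commute)
  qed
  define A where "A n = {\<omega>. \<forall>j\<in>{n0..n0 + n}. stage j \<omega>}" for n
  define x where "x n = coins.prob p (A n)" for n
  have depA: "depends_on (shallow (depth (n0 + n))) (\<lambda>\<omega>. \<forall>j\<in>{n0..n0 + n}. stage j \<omega>)" for n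
    unfolding depends_on_def
  proof (intro allI impI ball_cong refl)
    fix x y :: "nat list \<Rightarrow> bool" and j
    assume "\<forall>v\<in>shallow (depth (n0 + n)). x v = y v" "j \<in> {n0..n0 + n}"
    then show "stage j x = stage j y"
      by (intro depends_onD[OF depends_on_stage[of j "n0 + n"]]) auto
  qed
  have setsA: "A n \<in> sets (coin_field p)" for n
    unfolding A_def by (rule sets_depends_on[OF depA finite_shallow])
  have "p ^ card (shallow (depth n0)) \<le> x 0"
  proof -
    have "p ^ card (shallow (depth n0)) = coins.prob p {\<omega>. \<forall>v\<in>shallow (depth n0). \<omega> v}"
      using p_pos p_le by (simp add: prob_all_coins finite_shallow)
    also have "\<dots> \<le> x 0"
      unfolding x_def using setsA[of 0]
      by (intro coins.finite_measure_mono) (auto simp: A_def intro: stage_if_all_live)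
    finally show ?thesis .
  qed
  then have x0: "0 < x 0" using p_pos by (meson less_le_trans zero_less_power)
  have mono: "x n \<le> x 0" for n
    unfolding x_def by (intro coins.finite_measure_mono setsA) (auto simp: A_def)
  have step: "x n - x 0 * err (n0 + n) \<le> x (Suc n)" for n
  proof -
    have split: "A n = A (Suc n) \<union> (A n \<inter> {\<omega>. \<not> stage (Suc (n0 + n)) \<omega>})"
      by (auto simp: A_def le_Suc_eq)
    have disj: "A (Suc n) \<inter> (A n \<inter> {\<omega>. \<not> stage (Suc (n0 + n)) \<omega>}) = {}"
      by (auto simp: A_def)
    have "x n = x (Suc n) + coins.prob p (A n \<inter> {\<omega>. \<not> stage (Suc (n0 + n)) \<omega>})"
      unfolding x_def using split disj
      by (metis coins.finite_measure_Union setsA sets.Int sets_not_stage)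
    also have "coins.prob p (A n \<inter> {\<omega>. \<not> stage (Suc (n0 + n)) \<omega>}) \<le> x n * err (n0 + n)"
      unfolding x_def A_def by (rule prob_stage_step[OF depA]) auto
    also have "x n * err (n0 + n) \<le> x 0 * err (n0 + n)"
      by (intro mult_right_mono mono err_nonneg)
    finally show ?thesis by simp
  qed
  have "x 0 * (1 - (\<Sum>i<n. err (n0 + i))) \<le> x n" for n
  proof (induction n)
    case (Suc n)
    then show ?case using step[of n] by (simp add: algebra_simps)
  qed simp
  moreover have "x 0 * (1 / 2) \<le> x 0 * (1 - (\<Sum>i<n. err (n0 + i)))" for n
    using x0 tail[of n] by (intro mult_left_mono) auto
  ultimately have lower: "x 0 / 2 \<le> x n" for n by (metis order_trans times_divide_eq_right mult.right_neutral)
  have "(\<lambda>n. x n) \<longlonglongrightarrow> coins.prob p (\<Inter>n. A n)"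
    unfolding x_def using setsA
    by (intro coins.finite_Lim_measure_decseq) (auto simp: decseq_def A_def)
  then have "x 0 / 2 \<le> coins.prob p (\<Inter>n. A n)"
    using lower by (intro LIMSEQ_le_const) auto
  moreover have "(\<Inter>n. A n) = {\<omega>. \<forall>n\<ge>n0. stage n \<omega>}"
  proof (intro equalityI subsetI)
    fix \<omega> assume \<omega>: "\<omega> \<in> (\<Inter>n. A n)"
    have "stage n \<omega>" if "n0 \<le> n" for n
    proof -
      have "\<omega> \<in> A (n - n0)" using \<omega> by blast
      then show ?thesis using that by (simp add: A_def)
    qed
    then show "\<omega> \<in> {\<omega>. \<forall>n\<ge>n0. stage n \<omega>}" by simp
  qed (simp add: A_def)
  ultimately show ?thesis using x0 by (intro exI[of _ n0]) simp
qed

end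

section \<open>Coverings and the zero-one argument\<close>

text \<open>Dividing \<open>1 - g s\<close> by \<open>1 - s\<close>, for \<open>g s = 1 - p + p * s ^ M\<close>, gives \<open>p * (\<Sum>i<M. s ^ i)\<close>, which
  equals 1 at \<open>e\<close>, is at most 1 at \<open>a\<close>, and is strictly increasing because the sum contains the
  term \<open>i = 1\<close>.\<close>
lemma generating_function_fixed_point:
  fixes a e p :: real
  assumes p: "0 < p" and M: "2 \<le> M" and e: "0 \<le> e" "e \<le> a" and a: "a < 1"
    and fix_e: "e = 1 - p + p * e ^ M" and sub_a: "a \<le> 1 - p + p * a ^ M"
  shows "a = e"
proof (rule ccontr)
  assume "a \<noteq> e"
  with e have less: "e < a" by simp
  have "(1 - e) * (p * (\<Sum>i<M. e ^ i)) = p * (1 - e ^ M)"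
    by (simp add: one_diff_power_eq)
  also have "\<dots> = (1 - e) * 1" using fix_e by (simp add: algebra_simps)
  finally have 1: "p * (\<Sum>i<M. e ^ i) = 1" using less a by simp
  have "(1 - a) * (p * (\<Sum>i<M. a ^ i)) = p * (1 - a ^ M)"
    by (simp add: one_diff_power_eq)
  also have "\<dots> \<le> (1 - a) * 1" using sub_a by (simp add: algebra_simps)
  finally have 2: "p * (\<Sum>i<M. a ^ i) \<le> 1" using a by simp
  have "(\<Sum>i<M. e ^ i) < (\<Sum>i<M. a ^ i)"
    using less e M by (intro sum_strict_mono_ex1) (auto intro!: power_mono bexI[of _ 1])
  then have "p * (\<Sum>i<M. e ^ i) < p * (\<Sum>i<M. a ^ i)" using p by simp
  then show False using 1 2 by simp
qed

context covering_automaton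
begin

text \<open>The combinatorial form of \<open>J\<^sub>\<theta>\<^sub>0\<close> being contained in the random set: every subinterval of it
  is reached by a live word.\<close>
definition covered_to :: "nat \<Rightarrow> (nat list \<Rightarrow> bool) \<Rightarrow> bool" where
  "covered_to n x \<longleftrightarrow> (\<forall>\<theta>s\<in>finite_words L n. \<exists>w\<in>finite_words M (length \<theta>\<^sub>0 + n).
     live x w \<and> (\<exists>k<N. reach U (\<theta>\<^sub>0 @ \<theta>s) w k))"

definition covered :: "(nat list \<Rightarrow> bool) \<Rightarrow> bool" where
  "covered x \<longleftrightarrow> (\<forall>n. covered_to n x)"

lemma depends_on_live: "w \<in> finite_words M n \<Longrightarrow> depends_on (shallow n) (\<lambda>x. live x w)"
  unfolding depends_on_def
proof (intro allI impI live_cong)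
  fix x y :: "nat list \<Rightarrow> bool" and k
  assume "w \<in> finite_words M n" "\<forall>v\<in>shallow n. x v = y v" "k < length w"
  moreover from this have "take k w \<in> shallow n"
    by (auto simp: shallow_def finite_words_def dest: in_set_takeD)
  ultimately show "x (take k w) = y (take k w)" by blast
qed

lemma sets_live: "w \<in> finite_words M n \<Longrightarrow> {\<omega>. live \<omega> w} \<in> sets (coin_field p)"
  by (intro sets_depends_on[OF _ finite_shallow] depends_on_live)

lemma sets_covered: "{\<omega>. covered \<omega>} \<in> sets (coin_field p)"
proof -
  have "depends_on (shallow (length \<theta>\<^sub>0 + n)) (covered_to n)" for n
    unfolding depends_on_def
  proof (intro allI impI)
    fix x y :: "nat list \<Rightarrow> bool" assume "\<forall>v\<in>shallow (length \<theta>\<^sub>0 + n). x v = y v"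
    then have "live x w = live y w" if "w \<in> finite_words M (length \<theta>\<^sub>0 + n)" for w
      using depends_onD[OF depends_on_live[OF that]] by blast
    then show "covered_to n x = covered_to n y" unfolding covered_to_def by blast
  qed
  then have "{\<omega>. covered_to n \<omega>} \<in> sets (coin_field p)" for n
    by (rule sets_depends_on[OF _ finite_shallow])
  moreover have "{\<omega>. covered \<omega>} = (\<Inter>n. {\<omega>. covered_to n \<omega>})" by (auto simp: covered_def)
  ultimately show ?thesis by (auto intro!: sets.countable_INT)
qed

text \<open>A given digit word is prolonged to one that belongs to a late stage. Positive mass provides a live
  word for the prolongation, and a prefix of it serves the given word.\<close>
lemma covered_if_stages:
  assumes "\<forall>n\<ge>n0. stage n x"
  shows "covered x"
  unfolding covered_def covered_to_def
proof (intro allI ballI)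
  fix n \<theta>s assume \<theta>s: "\<theta>s \<in> finite_words L n"
  define n' where "n' = max n0 n"
  have n': "n \<le> n' * S" "n0 \<le> n'" using S_pos by (auto simp: n'_def intro: order_trans[of n "n * S"])
  obtain \<theta>r where \<theta>r: "\<theta>r \<in> finite_words L (n' * S - n)" using ex_word by blast
  have "\<theta>s @ \<theta>r \<in> finite_words L (n' * S)"
    using append_in_finite_words[of \<theta>s n \<theta>r L "n' * S - n"] \<theta>s \<theta>r n' by (simp add: length_finite_words)
  then have "has_mass (\<rho> ^ n') (live_count x U (\<theta>\<^sub>0 @ \<theta>s @ \<theta>r))"
    using assms n' by (simp add: stage_def)
  moreover have "0 < \<rho> ^ n'" using rho by simp
  ultimately obtain k where k: "k < N" "0 < live_count x U (\<theta>\<^sub>0 @ \<theta>s @ \<theta>r) k"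
    using has_mass_pos by blast
  define h where "h = length \<theta>\<^sub>0 + n"
  have len: "length (\<theta>\<^sub>0 @ \<theta>s) = h" using \<theta>s by (simp add: h_def length_finite_words)
  have "{w \<in> finite_words M (length (\<theta>\<^sub>0 @ \<theta>s @ \<theta>r)). live x w \<and> reach U (\<theta>\<^sub>0 @ \<theta>s @ \<theta>r) w k} \<noteq> {}"
    using k(2) unfolding live_count_def by (metis card.empty less_irrefl of_nat_0)
  then obtain w where w: "w \<in> finite_words M (length (\<theta>\<^sub>0 @ \<theta>s @ \<theta>r))" "live x w" "reach U (\<theta>\<^sub>0 @ \<theta>s @ \<theta>r) w k"
    by blast
  have lw: "length (take h w) = length (\<theta>\<^sub>0 @ \<theta>s)"
    using w(1) len by (simp add: length_finite_words h_def)
  have "reach U ((\<theta>\<^sub>0 @ \<theta>s) @ \<theta>r) (take h w @ drop h w) k" using w by simp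
  then obtain j where "j < N" "reach U (\<theta>\<^sub>0 @ \<theta>s) (take h w) j"
    unfolding reach_append[OF lw U_less] by blast
  moreover have "live x (take h w)"
    using w(2) live_append[of x "take h w" "drop h w"] by simp
  moreover have "take h w \<in> finite_words M (length \<theta>\<^sub>0 + n)"
    using take_in_finite_words[OF w(1), of h] len by (simp add: h_def)
  ultimately show "\<exists>w\<in>finite_words M (length \<theta>\<^sub>0 + n). live x w \<and> (\<exists>k<N. reach U (\<theta>\<^sub>0 @ \<theta>s) w k)"
    by blast
qed

lemma prob_covered_pos: "0 < coins.prob p {\<omega>. covered \<omega>}"
proof -
  obtain n0 where "0 < coins.prob p {\<omega>. \<forall>n\<ge>n0. stage n \<omega>}" using prob_all_stages_pos by blast
  also have "\<dots> \<le> coins.prob p {\<omega>. covered \<omega>}"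
    using covered_if_stages by (intro coins.finite_measure_mono sets_covered) auto
  finally show ?thesis .
qed

text \<open>Extinction at a finite time, which by Koenig's lemma is the absence of infinite surviving codes.\<close>
definition extinct :: "(nat list \<Rightarrow> bool) \<Rightarrow> bool" where
  "extinct x \<longleftrightarrow> (\<exists>n. \<forall>w\<in>finite_words M n. \<not> live x w)"

definition barren :: "(nat list \<Rightarrow> bool) \<Rightarrow> bool" where
  "barren x \<longleftrightarrow> (\<forall>n. \<forall>w\<in>finite_words M n. live x w \<longrightarrow> \<not> covered (coins_at w x))"

lemma no_live_mono:
  assumes "\<forall>w\<in>finite_words M n. \<not> live x w" "n \<le> n'"
  shows "\<forall>w\<in>finite_words M n'. \<not> live x w"
proof
  fix w assume w: "w \<in> finite_words M n'"
  have "\<not> live x (take n w)" using assms(1) take_in_finite_words[OF w assms(2)] by blast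
  then show "\<not> live x w" using live_append[of x "take n w" "drop n w"] by simp
qed

lemma extinct_iff: "extinct x \<longleftrightarrow> (x [] \<longrightarrow> (\<forall>i<M. extinct (coins_at [i] x)))"
proof
  assume "extinct x"
  then obtain n where n: "\<forall>w\<in>finite_words M n. \<not> live x w" by (auto simp: extinct_def)
  then have "\<forall>w\<in>finite_words M (Suc n). \<not> live x w" by (rule no_live_mono) simp
  then show "x [] \<longrightarrow> (\<forall>i<M. extinct (coins_at [i] x))"
    unfolding extinct_def by (auto simp: finite_words_Suc live_Cons)
next
  assume *: "x [] \<longrightarrow> (\<forall>i<M. extinct (coins_at [i] x))"
  show "extinct x"
  proof (cases "x []")
    case False
    then have "\<forall>w\<in>finite_words M (Suc 0). \<not> live x w" by (auto simp: finite_words_Suc live_Cons)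
    then show ?thesis by (auto simp: extinct_def)
  next
    case True
    then have "\<forall>i<M. \<exists>n. \<forall>w\<in>finite_words M n. \<not> live (coins_at [i] x) w"
      using * by (simp add: extinct_def)
    then obtain f where f: "\<And>i. i < M \<Longrightarrow> \<forall>w\<in>finite_words M (f i). \<not> live (coins_at [i] x) w" by metis
    have "\<forall>w\<in>finite_words M (Max (f ` {..<M})). \<not> live (coins_at [i] x) w" if "i < M" for i
      using that by (intro no_live_mono[OF f]) auto
    then have "\<forall>w\<in>finite_words M (Suc (Max (f ` {..<M}))). \<not> live x w"
      by (auto simp: finite_words_Suc live_Cons)
    then show ?thesis unfolding extinct_def by blast
  qed
qed

lemma barrenD: "barren x \<Longrightarrow> \<not> covered x"
  unfolding barren_def by (drule spec[of _ 0]) simp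

lemma barren_branch: "barren x \<Longrightarrow> x [] \<Longrightarrow> i < M \<Longrightarrow> barren (coins_at [i] x)"
  unfolding barren_def
proof (intro allI ballI impI)
  fix n w assume x: "\<forall>n. \<forall>w\<in>finite_words M n. live x w \<longrightarrow> \<not> covered (coins_at w x)"
    and "x []" "i < M" "w \<in> finite_words M n" "live (coins_at [i] x) w"
  then have "i # w \<in> finite_words M (Suc n)" "live x (i # w)"
    by (auto simp: Cons_in_finite_words live_Cons)
  with x have "\<not> covered (coins_at (i # w) x)" by blast
  then show "\<not> covered (coins_at w (coins_at [i] x))" by (simp add: coins_at_coins_at)
qed

text \<open>A copy with the covering property has live words of every length.\<close>
lemma extinct_imp_barren: "extinct x \<Longrightarrow> barren x"
  unfolding barren_def
proof (intro allI ballI impI notI)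
  fix l w assume "extinct x" and w: "w \<in> finite_words M l" "live x w" and c: "covered (coins_at w x)"
  then obtain n where n: "\<forall>w\<in>finite_words M n. \<not> live x w" by (auto simp: extinct_def)
  obtain \<theta>s where "\<theta>s \<in> finite_words L n" using ex_word by blast
  with c obtain v where v: "v \<in> finite_words M (length \<theta>\<^sub>0 + n)" "live (coins_at w x) v"
    unfolding covered_def covered_to_def by blast
  have "w @ v \<in> finite_words M (l + (length \<theta>\<^sub>0 + n))"
    using append_in_finite_words[of w l v M] w v by (simp add: length_finite_words)
  moreover have "live x (w @ v)" using w v by (simp add: live_append)
  ultimately show False using no_live_mono[OF n, of "l + (length \<theta>\<^sub>0 + n)"] by auto
qed

lemma sets_extinct: "{\<omega>. extinct \<omega>} \<in> sets (coin_field p)"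
proof -
  have "{\<omega>. extinct \<omega>} = (\<Union>n. space (coin_field p) - (\<Union>w\<in>finite_words M n. {\<omega>. live \<omega> w}))"
    by (auto simp: extinct_def)
  also have "\<dots> \<in> sets (coin_field p)"
    by (intro sets.countable_UN'' sets.compl_sets sets.finite_UN) (auto intro: sets_live)
  finally show ?thesis .
qed

lemma sets_barren: "{\<omega>. barren \<omega>} \<in> sets (coin_field p)"
proof -
  have "{\<omega>. barren \<omega>} = - (\<Union>n. \<Union>w\<in>finite_words M n. {\<omega>. live \<omega> w} \<inter> (coins_at w -` {\<omega>. covered \<omega>}))"
    by (auto simp: barren_def)
  moreover have "coins_at w -` {\<omega>. covered \<omega>} \<in> sets (coin_field p)" for w
    using measurable_sets[OF measurable_coins_at[of w p] sets_covered] by simp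
  then have "(\<Union>n. \<Union>w\<in>finite_words M n. {\<omega>. live \<omega> w} \<inter> (coins_at w -` {\<omega>. covered \<omega>})) \<in> sets (coin_field p)"
    by (intro sets.countable_UN'' sets.finite_UN sets.Int) (auto intro: sets_live)
  from sets.compl_sets[OF this] have "- (\<Union>n. \<Union>w\<in>finite_words M n. {\<omega>. live \<omega> w} \<inter> (coins_at w -` {\<omega>. covered \<omega>})) \<in> sets (coin_field p)"
    by (simp add: Compl_eq_Diff_UNIV)
  ultimately show ?thesis by simp
qed

text \<open>Extinction is an event that satisfies the branching recursion exactly; being barren passes to the
  subtrees if the coin at the root succeeds, and has probability less than one.\<close>
lemma AE_extinct_if_barren: "AE \<omega> in coin_field p. barren \<omega> \<longrightarrow> extinct \<omega>"
proof -
  define a where "a = coins.prob p {\<omega>. barren \<omega>}"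
  define e where "e = coins.prob p {\<omega>. extinct \<omega>}"
  have p01: "0 \<le> p" "p \<le> 1" using p_pos p_le by auto
  have "e = coins.prob p {\<omega>. \<omega> [] \<longrightarrow> (\<forall>i<M. coins_at [i] \<omega> \<in> {\<omega>. extinct \<omega>})}"
    unfolding e_def
    by (intro arg_cong[where f="coins.prob p"] Collect_cong) (subst extinct_iff, simp only: mem_Collect_eq)
  then have e: "e = 1 - p + p * e ^ M"
    using prob_root_branching[OF p01 sets_extinct, of M] by (simp add: e_def)
  have "{\<omega> \<in> space (coin_field p). \<omega> [] \<longrightarrow> (\<forall>i<M. coins_at [i] \<omega> \<in> {\<omega>. barren \<omega>})} \<in> sets (coin_field p)"
    using sets_barren by measurable
  then have "a \<le> coins.prob p {\<omega>. \<omega> [] \<longrightarrow> (\<forall>i<M. coins_at [i] \<omega> \<in> {\<omega>. barren \<omega>})}"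
    unfolding a_def by (intro coins.finite_measure_mono) (auto intro: barren_branch)
  then have a: "a \<le> 1 - p + p * a ^ M"
    using prob_root_branching[OF p01 sets_barren, of M] by (simp add: a_def)
  have "a \<le> coins.prob p (space (coin_field p) - {\<omega>. covered \<omega>})"
    unfolding a_def by (intro coins.finite_measure_mono sets.compl_sets sets_covered) (auto dest: barrenD)
  then have a1: "a < 1" using prob_covered_pos coins.prob_compl[OF sets_covered] by simp
  have "e \<le> a"
    unfolding a_def e_def by (intro coins.finite_measure_mono sets_barren) (auto intro: extinct_imp_barren)
  then have "a = e"
    using generating_function_fixed_point[OF p_pos M_ge_2 _ _ a1 e a] by (simp add: e_def)
  then have "coins.prob p ({\<omega>. barren \<omega>} - {\<omega>. extinct \<omega>}) = 0"
    using sets_barren sets_extinct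
    by (subst coins.finite_measure_Diff) (auto simp: a_def e_def intro: extinct_imp_barren)
  then have "AE \<omega> in coin_field p. \<omega> \<notin> {\<omega>. barren \<omega>} - {\<omega>. extinct \<omega>}"
    using sets_barren sets_extinct by (subst (asm) coins.prob_eq_0) auto
  then show ?thesis by simp
qed

end

section \<open>Base-\<open>L\<close> expansions and basic intervals\<close>

lemma S_word_Nil [simp]: "S_word L t [] x = x"
  by (simp add: S_word_def)

lemma S_word_Cons [simp]: "S_word L t (l # w) x = S_map L t l (S_word L t w x)"
  by (simp add: S_word_def)

lemma S_word_append: "S_word L t (v @ w) x = S_word L t v (S_word L t w x)"
  by (induction v) simp_all

lemma S_word_diff:
  "S_word L t w x - S_word L t w y = (x - y) / real L ^ length w"
proof (induction w)
  case (Cons l w)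
  have "S_word L t (l # w) x - S_word L t (l # w) y = (S_word L t w x - S_word L t w y) / real L"
    by (simp add: S_map_def diff_divide_distrib)
  then show ?case using Cons by simp
qed simp

text \<open>The number in \<open>[0, 1]\<close> with the base-\<open>L\<close> digits \<open>\<theta>s\<close>: the subinterval of the basic interval
  \<open>[b L, (b + 1) L]\<close> with digit word \<open>\<theta>s\<close> has left end point \<open>L * (b + digit_value L \<theta>s)\<close>.\<close>
fun digit_value :: "nat \<Rightarrow> nat list \<Rightarrow> real" where
  "digit_value L [] = 0"
| "digit_value L (\<theta> # \<theta>s) = (real \<theta> + digit_value L \<theta>s) / real L"

lemma digit_value_append: "digit_value L (\<theta>s @ \<theta>t) = digit_value L \<theta>s + digit_value L \<theta>t / real L ^ length \<theta>s"
  by (induction \<theta>s) (auto simp: add_divide_distrib divide_divide_eq_left mult.commute)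

lemma ex_digits:
  assumes L: "0 < L" and y: "0 \<le> y" "y < 1"
  shows "\<exists>\<theta>s\<in>finite_words L n. digit_value L \<theta>s \<le> y \<and> y \<le> digit_value L \<theta>s + 1 / real L ^ n"
  using y
proof (induction n arbitrary: y)
  case (Suc n)
  define \<theta> where "\<theta> = nat \<lfloor>y * real L\<rfloor>"
  define z where "z = y * real L - real \<theta>"
  have fl: "real \<theta> = real_of_int \<lfloor>y * real L\<rfloor>"
    using Suc.prems by (simp add: \<theta>_def)
  have z: "0 \<le> z" "z < 1" unfolding z_def fl by linarith+
  have "real \<theta> < real L"
  proof -
    have "real \<theta> \<le> y * real L" unfolding fl by linarith
    also have "\<dots> < real L" using Suc.prems L by simp
    finally show ?thesis .
  qed
  then have \<theta>: "\<theta> < L" by simp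
  obtain \<theta>s where \<theta>s: "\<theta>s \<in> finite_words L n" "digit_value L \<theta>s \<le> z" "z \<le> digit_value L \<theta>s + 1 / real L ^ n"
    using Suc.IH[OF z] by blast
  have y: "y = (real \<theta> + z) / real L" using L by (simp add: z_def)
  have "digit_value L (\<theta> # \<theta>s) \<le> y"
    unfolding y using \<theta>s L by (simp add: divide_right_mono)
  moreover have "y \<le> digit_value L (\<theta> # \<theta>s) + 1 / real L ^ Suc n"
  proof -
    have "(real \<theta> + z) / real L \<le> (real \<theta> + (digit_value L \<theta>s + 1 / real L ^ n)) / real L"
      using \<theta>s L by (intro divide_right_mono) auto
    then show ?thesis unfolding y using L by (simp add: add_divide_distrib mult.commute)
  qed
  ultimately show ?case
    using \<theta> \<theta>s by (intro bexI[of _ "\<theta> # \<theta>s"]) (auto simp: Cons_in_finite_words)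
qed simp

lemma index_mult_mat_sum:
  fixes A B :: "real mat"
  assumes "A \<in> carrier_mat n1 n2" "B \<in> carrier_mat n2 n3" "i < n1" "k < n3"
  shows "(A * B) $$ (i, k) = (\<Sum>j<n2. A $$ (i, j) * B $$ (j, k))"
  using assms by (simp add: scalar_prod_def atLeast0LessThan)

definition letter_step :: "nat \<Rightarrow> nat list \<Rightarrow> nat \<Rightarrow> nat \<Rightarrow> nat \<Rightarrow> nat \<Rightarrow> bool" where
  "letter_step L t i \<theta> l k \<longleftrightarrow> S_map L t l ` basic_interval L t k = subinterval L t i [\<theta>]"

text \<open>Two compact intervals that are equal have the same left end point.\<close>
lemma letter_step_eq:
  assumes L: "0 < L" and step: "letter_step L t i \<theta> l k"
  shows "real_of_int (basic_b L t k) + real (t ! l) = real_of_int (basic_b L t i) * real L + real \<theta>"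
proof (rule antisym)
  let ?b = "basic_b L t"
  have "real_of_int (?b k) * real L \<in> basic_interval L t k"
    by (auto simp: basic_interval_def algebra_simps)
  then have "S_map L t l (real_of_int (?b k) * real L) \<in> subinterval L t i [\<theta>]"
    using step by (auto simp: letter_step_def)
  then show "real_of_int (?b i) * real L + real \<theta> \<le> real_of_int (?b k) + real (t ! l)"
    using L by (simp add: subinterval_def S_map_def Let_def)
  have "real_of_int (?b i) * real L + real \<theta> \<in> subinterval L t i [\<theta>]"
    by (simp add: subinterval_def Let_def)
  then obtain y where y: "y \<in> basic_interval L t k" "S_map L t l y = real_of_int (?b i) * real L + real \<theta>"
    using step unfolding letter_step_def by (metis imageE)
  have "real_of_int (?b k) \<le> y / real L"
    using y(1) L by (simp add: basic_interval_def field_simps)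
  then show "real_of_int (?b k) + real (t ! l) \<le> real_of_int (?b i) * real L + real \<theta>"
    using y(2) by (simp add: S_map_def)
qed

lemma basic_b_inj:
  assumes "basic_b L t k = basic_b L t k'" "k < num_basic L t" "k' < num_basic L t"
  shows "k = k'"
proof -
  have "finite (basic_indices L t)" using assms(2) unfolding num_basic_def by (metis card.infinite not_less0)
  then have "length (sorted_list_of_set (basic_indices L t)) = num_basic L t"
    by (simp add: num_basic_def)
  then show ?thesis
    using assms nth_eq_iff_index_eq[OF distinct_sorted_list_of_set, of k "basic_indices L t" k']
    by (simp add: basic_b_def)
qed

text \<open>The basic intervals as states of the automaton. Their indices are distinct, which makes the
  transitions deterministic.\<close>
locale coin_issifs =
  fixes L :: nat and t :: "nat list" and p :: real
  assumes L_ge_2: "2 \<le> L" and p_pos: "0 < p" and p_le: "p \<le> 1"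

sublocale coin_issifs \<subseteq> coin_automaton "letter_step L t" "num_basic L t" "length t" p
proof
  fix i \<theta> l k k'
  assume *: "letter_step L t i \<theta> l k" "letter_step L t i \<theta> l k'" "k < num_basic L t" "k' < num_basic L t"
  have "real_of_int (basic_b L t k) = real_of_int (basic_b L t k')"
    using letter_step_eq[OF _ *(1)] letter_step_eq[OF _ *(2)] L_ge_2 by simp
  then show "k = k'" using * basic_b_inj by simp
qed (rule p_pos p_le)+

context coin_issifs
begin

text \<open>Along a path of the automaton the left end point of the final basic interval is carried to the
  left end point of the subinterval described by the digits.\<close>
lemma reach_S_word:
  "reach i \<theta>s w k \<Longrightarrow> S_word L t w (real_of_int (basic_b L t k) * real L)
     = real L * (real_of_int (basic_b L t i) + digit_value L \<theta>s)"
proof (induction i \<theta>s w k rule: reach.induct)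
  case (2 i \<theta> \<theta>s l w k)
  then obtain j where j: "j < num_basic L t" "letter_step L t i \<theta> l j" "reach j \<theta>s w k" by auto
  have "S_word L t (l # w) (real_of_int (basic_b L t k) * real L)
      = real_of_int (basic_b L t j) + digit_value L \<theta>s + real (t ! l)"
    using 2(1)[OF j(3)] L_ge_2 by (simp add: S_map_def)
  also have "\<dots> = real_of_int (basic_b L t i) * real L + real \<theta> + digit_value L \<theta>s"
    using letter_step_eq[OF _ j(2)] L_ge_2 by simp
  also have "\<dots> = real L * (real_of_int (basic_b L t i) + digit_value L (\<theta> # \<theta>s))"
    using L_ge_2 by (simp add: field_simps)
  finally show ?case .
qed (simp_all add: mult.commute)

lemma B_mat_index:
  "i < num_basic L t \<Longrightarrow> k < num_basic L t \<Longrightarrow> B_mat L t \<theta> $$ (i, k) = letter_count \<theta> i k"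
  by (simp add: B_mat_def letter_count_def letter_step_def)

lemma B_mat_carrier: "B_mat L t \<theta> \<in> carrier_mat (num_basic L t) (num_basic L t)"
  by (simp add: B_mat_def)

lemma B_word_carrier: "B_word L t \<theta>s \<in> carrier_mat (num_basic L t) (num_basic L t)"
  by (induction \<theta>s) (auto simp: B_word_def intro!: mult_carrier_mat[OF B_mat_carrier])

lemma M_word_carrier: "M_word L t p \<theta>s \<in> carrier_mat (num_basic L t) (num_basic L t)"
  by (induction \<theta>s) (auto simp: M_word_def M_mat_def intro!: mult_carrier_mat[OF smult_carrier_mat[OF B_mat_carrier]])

lemma B_word_index:
  "i < num_basic L t \<Longrightarrow> k < num_basic L t \<Longrightarrow> B_word L t \<theta>s $$ (i, k) = word_count \<theta>s i k"
proof (induction \<theta>s arbitrary: i)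
  case Nil
  then show ?case by (simp add: B_word_def word_count_Nil)
next
  case (Cons \<theta> \<theta>s)
  have "B_word L t (\<theta> # \<theta>s) = B_mat L t \<theta> * B_word L t \<theta>s" by (simp add: B_word_def)
  then show ?case
    using Cons by (simp add: index_mult_mat_sum[OF B_mat_carrier B_word_carrier] B_mat_index word_count_Cons)
qed

lemma M_word_index:
  "i < num_basic L t \<Longrightarrow> k < num_basic L t \<Longrightarrow> M_word L t p \<theta>s $$ (i, k) = p ^ length \<theta>s * word_count \<theta>s i k"
proof (induction \<theta>s arbitrary: i)
  case Nil
  then show ?case by (simp add: M_word_def word_count_Nil)
next
  case (Cons \<theta> \<theta>s)
  have M: "M_mat L t p \<theta> \<in> carrier_mat (num_basic L t) (num_basic L t)"
    using B_mat_carrier by (simp add: M_mat_def)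
  have ind: "M_mat L t p \<theta> $$ (i, j) = p * letter_count \<theta> i j" if "j < num_basic L t" for j
    using that Cons.prems B_mat_carrier[of \<theta>] by (auto simp: M_mat_def B_mat_index)
  have "M_word L t p (\<theta> # \<theta>s) = M_mat L t p \<theta> * M_word L t p \<theta>s" by (simp add: M_word_def)
  then show ?case
    using Cons by (simp add: index_mult_mat_sum[OF M M_word_carrier] ind word_count_Cons sum_distrib_left mult_ac)
qed

end

locale covering_issifs = coin_issifs +
  covering_automaton "letter_step L t" "num_basic L t" "length t" p L u m S \<gamma> U \<theta>\<^sub>0
  for u m S \<gamma> U \<theta>\<^sub>0
begin

text \<open>Each point \<open>y\<close> has base-\<open>L\<close> expansions of every length, and the covering property supplies a live word
  \<open>v\<close> for each of them, with \<open>S\<^sub>v\<close> carrying a basic interval close to the point. Hence live words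
  \<open>v\<close> of every length satisfy \<open>\<bar>S\<^sub>v 0 - q\<bar> \<le> C / L ^ length v\<close>, and a code all of whose
  prefixes do so projects to \<open>q\<close>. The constant \<open>C\<close> is taken at least twice as large as all
  translations, so that the inequality passes from a word to its prefixes, as Koenig's lemma
  requires: removing the last letter moves the point by at most \<open>C / 2\<close> in the scale of the prefix,
  and \<open>C / L \<le> C / 2\<close>.\<close>
lemma natural_proj_of_covered:
  assumes w: "w \<in> finite_words (length t) l" "live x w" and cov: "covered (coins_at w x)"
    and y: "0 \<le> y" "y < 1"
  shows "S_word L t w (real L * (real_of_int (basic_b L t U) + digit_value L \<theta>\<^sub>0 + y / real L ^ length \<theta>\<^sub>0))
    \<in> natural_proj L t ` {c \<in> codes (length t). \<forall>n. live x (code_prefix c n)}"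
proof -
  define q where "q = real L * (real_of_int (basic_b L t U) + digit_value L \<theta>\<^sub>0 + y / real L ^ length \<theta>\<^sub>0)"
  define C where "C = 2 * real (sum_list t) + real L * ((\<Sum>k<num_basic L t. \<bar>real_of_int (basic_b L t k)\<bar>) + 1)"
  have Lpos: "0 < real L" "1 \<le> real L" "2 \<le> real L" using L_ge_2 by auto
  define T where "T v \<longleftrightarrow> set v \<subseteq> {..<length t} \<and> live x v \<and>
     \<bar>S_word L t v 0 - S_word L t w q\<bar> \<le> C / real L ^ length v" for v
  have C0: "0 \<le> C" unfolding C_def by (auto intro!: add_nonneg_nonneg mult_nonneg_nonneg sum_nonneg)
  have CS: "2 * real (sum_list t) \<le> C"
    unfolding C_def by (auto intro!: mult_nonneg_nonneg add_nonneg_nonneg sum_nonneg)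
  have prefix1: "T v" if "T (v @ [i])" for v i
  proof -
    have i: "i < length t" using that by (simp add: T_def)
    have ti: "real (t ! i) \<le> real (sum_list t)" using elem_le_sum_list[OF i] by simp
    have d: "S_word L t (v @ [i]) 0 - S_word L t v 0 = real (t ! i) / real L ^ length v"
      using S_word_diff[of L t v "real (t ! i)" 0] by (simp add: S_word_append S_map_def)
    have "\<bar>S_word L t v 0 - S_word L t w q\<bar>
        \<le> \<bar>S_word L t (v @ [i]) 0 - S_word L t w q\<bar> + \<bar>S_word L t (v @ [i]) 0 - S_word L t v 0\<bar>"
      by linarith
    also have "\<dots> \<le> C / real L ^ Suc (length v) + real (t ! i) / real L ^ length v"
      using that unfolding d T_def by simp
    also have "\<dots> = (C / real L + real (t ! i)) / real L ^ length v"
      by (simp add: add_divide_distrib)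
    also have "\<dots> \<le> C / real L ^ length v"
    proof (intro divide_right_mono)
      have "C / real L \<le> C / 2" using Lpos C0 by (intro divide_left_mono) auto
      then show "C / real L + real (t ! i) \<le> C" using CS ti by linarith
    qed simp
    finally show ?thesis using that by (simp add: T_def live_append)
  qed
  have prefix: "T v" if "T (v @ u)" for v u
    using that
  proof (induction u rule: rev_induct)
    case (snoc i u)
    then show ?case using prefix1[of "v @ u" i] by simp
  qed simp
  have "\<exists>v\<in>finite_words (length t) n. T v" for n
  proof -
    obtain \<theta>s where \<theta>s: "\<theta>s \<in> finite_words L n" "digit_value L \<theta>s \<le> y" "y \<le> digit_value L \<theta>s + 1 / real L ^ n"
      using ex_digits[OF L_pos y] by blast
    obtain v k where v: "v \<in> finite_words (length t) (length \<theta>\<^sub>0 + n)" "live (coins_at w x) v"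
      "k < num_basic L t" "reach U (\<theta>\<^sub>0 @ \<theta>s) v k"
      using cov \<theta>s(1) unfolding covered_def covered_to_def by blast
    have len: "length v = length \<theta>\<^sub>0 + n" using v(1) by (rule length_finite_words)
    have bk: "\<bar>real_of_int (basic_b L t k)\<bar> \<le> (\<Sum>k<num_basic L t. \<bar>real_of_int (basic_b L t k)\<bar>)"
      using v(3) by (intro member_le_sum) auto
    have 1: "\<bar>S_word L t v 0 - S_word L t v (real_of_int (basic_b L t k) * real L)\<bar>
        = \<bar>real_of_int (basic_b L t k)\<bar> * real L / real L ^ length v"
      by (simp add: S_word_diff abs_mult)
    have "S_word L t v (real_of_int (basic_b L t k) * real L) - q
        = - (real L * (y - digit_value L \<theta>s) / real L ^ length \<theta>\<^sub>0)"
      unfolding reach_S_word[OF v(4)] q_def digit_value_append by (simp add: algebra_simps diff_divide_distrib)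
    then have "\<bar>S_word L t v (real_of_int (basic_b L t k) * real L) - q\<bar>
        = real L * (y - digit_value L \<theta>s) / real L ^ length \<theta>\<^sub>0"
      using \<theta>s by (simp add: abs_mult)
    also have "\<dots> \<le> real L * (1 / real L ^ n) / real L ^ length \<theta>\<^sub>0"
      using \<theta>s by (intro divide_right_mono mult_left_mono) auto
    also have "\<dots> = real L / real L ^ length v"
      by (simp add: len power_add mult.commute)
    finally have 2: "\<bar>S_word L t v (real_of_int (basic_b L t k) * real L) - q\<bar> \<le> real L / real L ^ length v" .
    have "\<bar>S_word L t v 0 - q\<bar> \<le> (\<bar>real_of_int (basic_b L t k)\<bar> * real L + real L) / real L ^ length v"
      using 1 2 by (simp only: add_divide_distrib)
    also have "\<dots> \<le> C / real L ^ length v"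
    proof (intro divide_right_mono)
      have "\<bar>real_of_int (basic_b L t k)\<bar> * real L + real L = real L * (\<bar>real_of_int (basic_b L t k)\<bar> + 1)"
        by (simp add: algebra_simps)
      also have "\<dots> \<le> real L * ((\<Sum>k<num_basic L t. \<bar>real_of_int (basic_b L t k)\<bar>) + 1)"
        using bk by (intro mult_left_mono) auto
      also have "\<dots> \<le> C" by (simp add: C_def)
      finally show "\<bar>real_of_int (basic_b L t k)\<bar> * real L + real L \<le> C" .
    qed simp
    finally have "\<bar>S_word L t v 0 - q\<bar> / real L ^ length w \<le> C / real L ^ length v / real L ^ length w"
      by (intro divide_right_mono) auto
    then have "\<bar>S_word L t (w @ v) 0 - S_word L t w q\<bar> \<le> C / real L ^ length (w @ v)"
      by (simp add: S_word_append S_word_diff power_add mult.commute)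
    then have "T (w @ v)"
      using w v by (auto simp: T_def live_append finite_words_def)
    then have "T (take n (w @ v) @ drop n (w @ v))" by (simp only: append_take_drop_id)
    then have Tn: "T (take n (w @ v))" by (rule prefix)
    moreover have "take n (w @ v) \<in> finite_words (length t) n"
      using Tn len by (simp add: finite_words_def T_def)
    ultimately show ?thesis by blast
  qed
  then obtain c where c: "c \<in> codes (length t)" "\<And>n. T (code_prefix c n)"
    using koenig_codes[of "length t" T] prefix by blast
  have "(\<lambda>n. S_word L t (code_prefix c n) 0) \<longlonglongrightarrow> S_word L t w q"
  proof (rule LIMSEQ_I)
    fix r :: real assume "0 < r"
    have "(\<lambda>n. C * (1 / real L) ^ n) \<longlonglongrightarrow> C * 0"
      using Lpos by (intro tendsto_mult tendsto_const LIMSEQ_power_zero) auto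
    then obtain n0 where n0: "\<And>n. n0 \<le> n \<Longrightarrow> C * (1 / real L) ^ n < r"
      using \<open>0 < r\<close> order_tendstoD(2)[of _ "C * 0" sequentially r] by (auto simp: eventually_sequentially)
    have "norm (S_word L t (code_prefix c n) 0 - S_word L t w q) < r" if "n0 \<le> n" for n
    proof -
      have "norm (S_word L t (code_prefix c n) 0 - S_word L t w q) \<le> C * (1 / real L) ^ n"
        using c(2)[of n] by (simp add: T_def code_prefix_def power_divide)
      then show ?thesis using n0[OF that] by linarith
    qed
    then show "\<exists>no. \<forall>n\<ge>no. norm (S_word L t (code_prefix c n) 0 - S_word L t w q) < r" by blast
  qed
  then have "natural_proj L t c = S_word L t w q"
    unfolding natural_proj_def by (rule limI)
  then show ?thesis using c unfolding q_def T_def by force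
qed

lemma contains_interval_of_covered:
  assumes w: "w \<in> finite_words (length t) l" "live x w" and cov: "covered (coins_at w x)"
  shows "contains_interval (natural_proj L t ` {c \<in> codes (length t). \<forall>n. live x (code_prefix c n)})"
proof -
  define q where "q y = real L * (real_of_int (basic_b L t U) + digit_value L \<theta>\<^sub>0 + y / real L ^ length \<theta>\<^sub>0)" for y
  define s where "s = real L / real L ^ length \<theta>\<^sub>0 / real L ^ length w"
  have s: "0 < s" using L_pos by (simp add: s_def)
  have q: "S_word L t w (q y) = S_word L t w (q 0) + s * y" for y
  proof -
    have "S_word L t w (q y) - S_word L t w (q 0) = s * y"
      by (simp add: S_word_diff q_def s_def algebra_simps)
    then show ?thesis by simp
  qed
  have "{S_word L t w (q 0)..S_word L t w (q 0) + s / 2}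
      \<subseteq> natural_proj L t ` {c \<in> codes (length t). \<forall>n. live x (code_prefix c n)}"
  proof
    fix z assume z: "z \<in> {S_word L t w (q 0)..S_word L t w (q 0) + s / 2}"
    define y where "y = (z - S_word L t w (q 0)) / s"
    have y: "0 \<le> y" "y < 1" using z s by (auto simp: y_def field_simps)
    have "z = S_word L t w (q y)" using q[of y] s by (simp add: y_def)
    then show "z \<in> natural_proj L t ` {c \<in> codes (length t). \<forall>n. live x (code_prefix c n)}"
      using natural_proj_of_covered[OF assms y] by (simp add: q_def)
  qed
  moreover have "S_word L t w (q 0) < S_word L t w (q 0) + s / 2" using s by simp
  ultimately show ?thesis unfolding contains_interval_def by blast
qed

end

section \<open>Transfer to the given coins\<close>

text \<open>Given coins exist at nonempty words only, so the field of the product measure, with its coin at the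
  root, is matched with the coins at and below a child of the root.\<close>
lemma coin_tossing_subtree_law:
  fixes X :: "nat list \<Rightarrow> 'a \<Rightarrow> bool"
  assumes ct: "coin_tossing P M p X" and i: "i < M"
  defines "W \<equiv> \<Union>n. finite_words M n"
  shows "(\<lambda>\<omega>. \<lambda>v\<in>W. X (i # v) \<omega>) \<in> P \<rightarrow>\<^sub>M (\<Pi>\<^sub>M v\<in>W. count_space UNIV)"
    and "distr P (\<Pi>\<^sub>M v\<in>W. count_space UNIV) (\<lambda>\<omega>. \<lambda>v\<in>W. X (i # v) \<omega>)
      = distr (coin_field p) (\<Pi>\<^sub>M v\<in>W. count_space UNIV) (\<lambda>\<omega>. restrict \<omega> W)"
proof -
  interpret P: prob_space P using ct by (simp add: coin_tossing_def)
  define I where "I = (\<Union>n\<in>{1..}. finite_words M n)"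
  define \<beta> where "\<beta> = measure_pmf (bernoulli_pmf p)"
  have indep: "P.indep_vars (\<lambda>_. count_space UNIV) X I"
    and law: "\<And>w. w \<in> I \<Longrightarrow> distr P (count_space UNIV) (X w) = \<beta>"
    using ct unfolding coin_tossing_def I_def \<beta>_def by auto
  have rv: "X w \<in> P \<rightarrow>\<^sub>M count_space UNIV" if "w \<in> I" for w
    using indep that unfolding P.indep_vars_def by blast
  have child: "i # v \<in> I" if v: "v \<in> W" for v
  proof -
    obtain n where "v \<in> finite_words M n" using v by (auto simp: W_def)
    then show ?thesis using i by (auto simp: I_def Cons_in_finite_words intro!: bexI[of _ "Suc n"])
  qed
  have "[] \<in> W" unfolding W_def by (intro UN_I[of 0]) auto
  then have ne: "I \<noteq> {}" using child by blast
  have prob_beta: "prob_space \<beta>" unfolding \<beta>_def by (rule prob_space_measure_pmf)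
  have sets_beta: "sets (\<Pi>\<^sub>M v\<in>J. \<beta>) = sets (\<Pi>\<^sub>M v\<in>J. count_space UNIV)" for J :: "nat list set"
    by (intro sets_PiM_cong) (auto simp: \<beta>_def)
  have XI: "distr P (\<Pi>\<^sub>M v\<in>I. count_space UNIV) (\<lambda>\<omega>. \<lambda>v\<in>I. X v \<omega>) = (\<Pi>\<^sub>M v\<in>I. \<beta>)"
  proof -
    have "distr P (\<Pi>\<^sub>M v\<in>I. count_space UNIV) (\<lambda>\<omega>. \<lambda>v\<in>I. X v \<omega>)
        = (\<Pi>\<^sub>M v\<in>I. distr P (count_space UNIV) (X v))"
      using P.indep_vars_iff_distr_eq_PiM'[OF ne, of X "\<lambda>_. count_space UNIV"] rv indep by blast
    also have "\<dots> = (\<Pi>\<^sub>M v\<in>I. \<beta>)" by (intro PiM_cong refl law)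
    finally show ?thesis .
  qed
  have mI: "(\<lambda>\<omega>. \<lambda>v\<in>I. X v \<omega>) \<in> P \<rightarrow>\<^sub>M (\<Pi>\<^sub>M v\<in>I. count_space UNIV)"
    using rv by (intro measurable_restrict) auto
  have mW: "(\<lambda>x. \<lambda>v\<in>W. x (i # v)) \<in> (\<Pi>\<^sub>M v\<in>I. count_space UNIV) \<rightarrow>\<^sub>M (\<Pi>\<^sub>M v\<in>W. count_space (UNIV :: bool set))"
    using child by (intro measurable_restrict) auto
  show m: "(\<lambda>\<omega>. \<lambda>v\<in>W. X (i # v) \<omega>) \<in> P \<rightarrow>\<^sub>M (\<Pi>\<^sub>M v\<in>W. count_space UNIV)"
    using rv child by (intro measurable_restrict) auto
  have comp: "(\<lambda>x. \<lambda>v\<in>W. x (i # v)) \<circ> (\<lambda>\<omega>. \<lambda>v\<in>I. X v \<omega>) = (\<lambda>\<omega>. \<lambda>v\<in>W. X (i # v) \<omega>)"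
    using child by (auto simp: fun_eq_iff restrict_def)
  have "distr P (\<Pi>\<^sub>M v\<in>W. count_space UNIV) (\<lambda>\<omega>. \<lambda>v\<in>W. X (i # v) \<omega>)
      = distr (distr P (\<Pi>\<^sub>M v\<in>I. count_space UNIV) (\<lambda>\<omega>. \<lambda>v\<in>I. X v \<omega>))
          (\<Pi>\<^sub>M v\<in>W. count_space UNIV) (\<lambda>x. \<lambda>v\<in>W. x (i # v))"
    using distr_distr[OF mW mI] by (simp only: comp)
  also have "\<dots> = distr (\<Pi>\<^sub>M v\<in>I. \<beta>) (\<Pi>\<^sub>M v\<in>W. \<beta>) (\<lambda>x. \<lambda>v\<in>W. x (i # v))"
    unfolding XI by (intro distr_cong refl sets_beta[symmetric])
  also have "\<dots> = (\<Pi>\<^sub>M v\<in>W. \<beta>)"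
    using child by (intro distr_PiM_reindex[where M="\<lambda>_. \<beta>"]) (auto intro: prob_beta inj_onI)
  also have "\<dots> = distr (coin_field p) (\<Pi>\<^sub>M v\<in>W. \<beta>) (\<lambda>\<omega>. \<lambda>v\<in>W. \<omega> v)"
    unfolding coin_field_def \<beta>_def[symmetric]
    by (rule distr_PiM_reindex[where M="\<lambda>_. \<beta>", symmetric]) (auto intro: prob_beta)
  also have "\<dots> = distr (coin_field p) (\<Pi>\<^sub>M v\<in>W. count_space UNIV) (\<lambda>\<omega>. restrict \<omega> W)"
    by (intro distr_cong refl sets_beta)
  finally show "distr P (\<Pi>\<^sub>M v\<in>W. count_space UNIV) (\<lambda>\<omega>. \<lambda>v\<in>W. X (i # v) \<omega>)
      = distr (coin_field p) (\<Pi>\<^sub>M v\<in>W. count_space UNIV) (\<lambda>\<omega>. restrict \<omega> W)" .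
qed

lemma AE_coin_tossing_subtree:
  fixes X :: "nat list \<Rightarrow> 'a \<Rightarrow> bool"
  assumes ct: "coin_tossing P M p X" and i: "i < M"
    and sets: "{\<omega>. \<Phi> \<omega>} \<in> sets (coin_field p)"
    and cong: "\<And>x y. (\<And>n w. w \<in> finite_words M n \<Longrightarrow> x w = y w) \<Longrightarrow> \<Phi> x = \<Phi> y"
    and ae: "AE \<omega> in coin_field p. \<Phi> \<omega>"
  shows "AE \<omega> in P. \<Phi> (\<lambda>v. X (i # v) \<omega>)"
proof -
  define W where "W = (\<Union>n. finite_words M n)"
  define Q where "Q = (\<Pi>\<^sub>M v\<in>W. count_space (UNIV :: bool set))"
  define e where "e y = (\<lambda>v. if v \<in> W then y v else False)" for y :: "nat list \<Rightarrow> bool"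
  have e: "e \<in> Q \<rightarrow>\<^sub>M coin_field p"
  proof -
    have "e \<in> Q \<rightarrow>\<^sub>M (\<Pi>\<^sub>M v\<in>UNIV. count_space UNIV)"
      unfolding e_def Q_def by (intro measurable_PiM_single') (auto simp: PiE_def extensional_def)
    then show ?thesis unfolding measurable_cong_sets[OF refl sets_coin_field] .
  qed
  have setQ: "{x \<in> space Q. \<Phi> (e x)} \<in> sets Q"
    using measurable_sets[OF e sets] by (simp add: vimage_def Int_def conj_commute)
  have cong_e: "\<Phi> (e (restrict x W)) = \<Phi> x" for x
    by (intro cong) (auto simp: e_def W_def)
  have r: "(\<lambda>\<omega>. restrict \<omega> W) \<in> coin_field p \<rightarrow>\<^sub>M Q"
    unfolding Q_def by (intro measurable_restrict) measurable
  have "AE x in distr (coin_field p) Q (\<lambda>\<omega>. restrict \<omega> W). \<Phi> (e x)"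
    using ae by (subst AE_distr_iff[OF r setQ]) (simp add: cong_e)
  then have "AE x in distr P Q (\<lambda>\<omega>. \<lambda>v\<in>W. X (i # v) \<omega>). \<Phi> (e x)"
    unfolding Q_def W_def coin_tossing_subtree_law(2)[OF ct i] .
  then have "AE \<omega> in P. \<Phi> (e (\<lambda>v\<in>W. X (i # v) \<omega>))"
    using coin_tossing_subtree_law(1)[OF ct i] unfolding Q_def W_def by (rule AE_distrD[rotated])
  then show ?thesis by (simp only: cong_e)
qed

context covering_automaton
begin

lemma live_word_cong:
  assumes "\<And>n w. w \<in> finite_words M n \<Longrightarrow> x w = y w" "w \<in> finite_words M l"
  shows "live x w = live y w"
proof (rule live_cong)
  fix n assume "n < length w"
  then have "take n w \<in> finite_words M n"
    using assms(2) by (intro take_in_finite_words[OF assms(2)]) (simp add: length_finite_words)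
  then show "x (take n w) = y (take n w)" by (rule assms(1))
qed

lemma extinct_cong:
  assumes "\<And>n w. w \<in> finite_words M n \<Longrightarrow> x w = y w"
  shows "extinct x = extinct y"
  unfolding extinct_def using live_word_cong[OF assms] by (intro arg_cong[where f=Ex] ext ball_cong) auto

lemma covered_cong:
  assumes "\<And>n w. w \<in> finite_words M n \<Longrightarrow> x w = y w"
  shows "covered x = covered y"
  unfolding covered_def covered_to_def using live_word_cong[OF assms]
  by (intro arg_cong[where f=All] ext ball_cong bex_cong refl) auto

lemma barren_cong:
  assumes "\<And>n w. w \<in> finite_words M n \<Longrightarrow> x w = y w"
  shows "barren x = barren y"
proof -
  have "covered (coins_at w x) = covered (coins_at w y)" if w: "w \<in> finite_words M l" for w l
  proof (rule covered_cong)
    fix n v assume "v \<in> finite_words M n"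
    then have "w @ v \<in> finite_words M (l + n)"
      using append_in_finite_words[of w l v M n] w by (simp add: length_finite_words)
    then show "coins_at w x v = coins_at w y v" by (simp add: coins_at_def assms)
  qed
  then show ?thesis
    unfolding barren_def using live_word_cong[OF assms]
    by (intro arg_cong[where f=All] ext ball_cong refl) auto
qed

end

context covering_issifs
begin

lemma AE_contains_interval:
  fixes X :: "nat list \<Rightarrow> 'a \<Rightarrow> bool"
  assumes ct: "coin_tossing P (length t) p X"
  shows "AE \<omega> in P. surviving_codes (length t) X \<omega> \<noteq> {} \<longrightarrow> contains_interval (random_set L t X \<omega>)"
proof -
  have "AE \<omega> in P. barren (\<lambda>v. X (i # v) \<omega>) \<longrightarrow> extinct (\<lambda>v. X (i # v) \<omega>)" if "i < length t" for i
  proof (rule AE_coin_tossing_subtree[OF ct that, where \<Phi>="\<lambda>x. barren x \<longrightarrow> extinct x"])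
    have "{\<omega>. barren \<omega> \<longrightarrow> extinct \<omega>} = (space (coin_field p) - {\<omega>. barren \<omega>}) \<union> {\<omega>. extinct \<omega>}" by auto
    also have "\<dots> \<in> sets (coin_field p)"
      by (intro sets.Un sets.compl_sets sets_barren sets_extinct)
    finally show "{\<omega>. barren \<omega> \<longrightarrow> extinct \<omega>} \<in> sets (coin_field p)" .
    show "AE \<omega> in coin_field p. barren \<omega> \<longrightarrow> extinct \<omega>" by (rule AE_extinct_if_barren)
  next
    fix x y :: "nat list \<Rightarrow> bool"
    assume xy: "\<And>n w. w \<in> finite_words (length t) n \<Longrightarrow> x w = y w"
    show "(barren x \<longrightarrow> extinct x) = (barren y \<longrightarrow> extinct y)"
      using barren_cong[OF xy] extinct_cong[OF xy] by simp
  qed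
  then have "AE \<omega> in P. \<forall>i\<in>{..<length t}. barren (\<lambda>v. X (i # v) \<omega>) \<longrightarrow> extinct (\<lambda>v. X (i # v) \<omega>)"
    by (intro AE_finite_allI) auto
  then show ?thesis
  proof eventually_elim
    fix \<omega> assume *: "\<forall>i\<in>{..<length t}. barren (\<lambda>v. X (i # v) \<omega>) \<longrightarrow> extinct (\<lambda>v. X (i # v) \<omega>)"
    show "surviving_codes (length t) X \<omega> \<noteq> {} \<longrightarrow> contains_interval (random_set L t X \<omega>)"
    proof
      assume "surviving_codes (length t) X \<omega> \<noteq> {}"
      then obtain c where c: "c \<in> codes (length t)" "\<And>n. 1 \<le> n \<Longrightarrow> X (code_prefix c n) \<omega>"
        by (auto simp: surviving_codes_def)
      define i where "i = c 0"
      define x where "x = (\<lambda>v. X (i # v) \<omega>)"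
      \<comment> \<open>the given coins, completed by a successful coin at the root\<close>
      define x0 where "x0 = (\<lambda>v. v = [] \<or> X v \<omega>)"
      have i: "i < length t" using c(1) by (auto simp: codes_def i_def)
      have pre: "code_prefix c (Suc n) = i # code_prefix (\<lambda>n. c (Suc n)) n" for n
        unfolding code_prefix_def i_def by (simp add: upt_conv_Cons map_Suc_upt[symmetric] del: upt_Suc)
      have "\<not> extinct x"
      proof
        assume "extinct x"
        then obtain n where n: "\<forall>w\<in>finite_words (length t) n. \<not> live x w" by (auto simp: extinct_def)
        define w where "w = code_prefix (\<lambda>n. c (Suc n)) n"
        have "w \<in> finite_words (length t) n"
          using c(1) by (auto simp: w_def code_prefix_def finite_words_def codes_def)
        moreover have "live x w"
          unfolding live_def
        proof (intro allI impI)
          fix k assume "k < length w"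
          then have "take k w = code_prefix (\<lambda>n. c (Suc n)) k"
            by (simp add: w_def code_prefix_def take_map)
          then show "x (take k w)" using c(2)[of "Suc k"] by (simp add: x_def pre)
        qed
        ultimately show False using n by blast
      qed
      then have "\<not> barren x" using * i by (auto simp: x_def)
      then obtain l w where w: "w \<in> finite_words (length t) l" "live x w" "covered (coins_at w x)"
        by (auto simp: barren_def)
      have x: "coins_at [i] x0 = x" by (auto simp: coins_at_def x0_def x_def)
      have "i # w \<in> finite_words (length t) (Suc l)" using w i by (simp add: Cons_in_finite_words)
      moreover have "live x0 (i # w)" using w by (simp add: live_Cons x) (simp add: x0_def)
      moreover have "covered (coins_at (i # w) x0)"
        using w coins_at_coins_at[of w "[i]" x0] by (simp add: x)
      ultimately have "contains_interval (natural_proj L t ` {c \<in> codes (length t). \<forall>n. live x0 (code_prefix c n)})"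
        by (rule contains_interval_of_covered)
      moreover have "{c \<in> codes (length t). \<forall>n. live x0 (code_prefix c n)} \<subseteq> surviving_codes (length t) X \<omega>"
      proof
        fix c assume "c \<in> {c \<in> codes (length t). \<forall>n. live x0 (code_prefix c n)}"
        then have c: "c \<in> codes (length t)" "\<And>n. live x0 (code_prefix c n)" by auto
        have "X (code_prefix c n) \<omega>" if "1 \<le> n" for n
        proof -
          have length_prefix: "n < length (code_prefix c (Suc n))" by (simp add: code_prefix_def)
          have "take n (code_prefix c (Suc n)) = code_prefix c n" by (simp add: code_prefix_def)
          moreover have "x0 (take n (code_prefix c (Suc n)))"
            using c(2)[of "Suc n"] length_prefix unfolding live_def by blast
          ultimately show ?thesis using that by (auto simp: x0_def code_prefix_def)
        qed
        then show "c \<in> surviving_codes (length t) X \<omega>" using c(1) by (auto simp: surviving_codes_def)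
      qed
      ultimately show "contains_interval (random_set L t X \<omega>)"
        unfolding contains_interval_def random_set_def by (meson image_mono order_trans)
    qed
  qed
qed

end

theorem proposition7p1:
  fixes L :: nat and t :: "nat list" and p :: real
    and P :: "'a measure" and X :: "nat list \<Rightarrow> 'a \<Rightarrow> bool"
    and us :: "nat Matrix.vec list"
  assumes "issifs L t"
    and "0 < p" and "p \<le> 1"
    and "coin_tossing P (length t) p X"
    and "us \<noteq> []" and "distinct us"
    and "set us \<subseteq> carrier_vec (num_basic L t) - {0\<^sub>v (num_basic L t)}"
    and "\<exists>ustar \<in> set us. \<exists>Sstar \<ge> 1. \<exists>\<theta>star \<in> finite_words L Sstar. \<exists>Ustar < num_basic L t.
           mat_of_row (unit_vec (num_basic L t) Ustar) * B_word L t \<theta>star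
             \<ge> mat_of_row (map_vec real ustar) \<and>
           interior (attractor L t \<inter> subinterval L t Ustar \<theta>star) \<noteq> {}"
    and "\<exists>\<gamma> > 1. \<exists>S'. \<forall>\<theta>s \<in> finite_words L S'.
           \<exists>A \<in> carrier_mat (length us) (length us).
             (\<forall>i < length us. \<forall>j < length us. A $$ (i, j) \<ge> 0) \<and>
             (\<forall>i < length us. (\<Sum>j<length us. A $$ (i, j)) > \<gamma>) \<and>
             rows_mat (num_basic L t) us * M_word L t p \<theta>s
               \<ge> A * rows_mat (num_basic L t) us"
  shows "AE \<omega> in P. surviving_codes (length t) X \<omega> \<noteq> {} \<longrightarrow>
           contains_interval (random_set L t X \<omega>)"
proof -
  interpret coin_issifs L t p
    using assms(1-3) by unfold_locales (auto simp: issifs_def)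
  define N where "N = num_basic L t"
  define m where "m = length us"
  define u where "u i k = vec_index (us ! i) k" for i k
  have dim: "us ! i \<in> carrier_vec N" "us ! i \<noteq> 0\<^sub>v N" if "i < m" for i
  proof -
    have "us ! i \<in> set us" using that by (simp add: m_def)
    then show "us ! i \<in> carrier_vec N" "us ! i \<noteq> 0\<^sub>v N" using assms(7) by (auto simp: N_def)
  qed
  obtain ustar \<theta>star Ustar where start: "ustar \<in> set us" "Ustar < N"
    "mat_of_row (map_vec real ustar) \<le> mat_of_row (unit_vec N Ustar) * B_word L t \<theta>star"
    using assms(8) unfolding N_def by blast
  obtain \<gamma> S' where gamma: "1 < \<gamma>" and growth: "\<forall>\<theta>s \<in> finite_words L S'.
           \<exists>A \<in> carrier_mat m m. (\<forall>i < m. \<forall>j < m. A $$ (i, j) \<ge> 0) \<and>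
             (\<forall>i < m. (\<Sum>j<m. A $$ (i, j)) > \<gamma>) \<and>
             A * rows_mat N us \<le> rows_mat N us * M_word L t p \<theta>s"
    using assms(9) unfolding N_def m_def by blast
  have rows: "rows_mat N us \<in> carrier_mat m N"
    using mat_of_rows_carrier(1)[of N "map (map_vec real) us"] by (simp add: rows_mat_def m_def)
  have rows_index: "rows_mat N us $$ (i, k) = real (u i k)" if "i < m" "k < N" for i k
    using that dim[OF that(1)] by (simp add: rows_mat_def m_def u_def mat_of_rows_def)
  have Mw: "M_word L t p \<theta>s \<in> carrier_mat N N" for \<theta>s unfolding N_def by (rule M_word_carrier)
  have Bc: "B_word L t \<theta>s \<in> carrier_mat N N" for \<theta>s unfolding N_def by (rule B_word_carrier)
  have Mi: "M_word L t p \<theta>s $$ (i, k) = p ^ length \<theta>s * word_count \<theta>s i k" if "i < N" "k < N" for \<theta>s i k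
    using that unfolding N_def by (rule M_word_index)
  have Bi: "B_word L t \<theta>s $$ (i, k) = word_count \<theta>s i k" if "i < N" "k < N" for \<theta>s i k
    using that unfolding N_def by (rule B_word_index)
  have "covering_automaton (letter_step L t) N (length t) p L u m S' \<gamma> Ustar \<theta>star"
    unfolding N_def
  proof unfold_locales
    show "0 < L" using L_ge_2 by simp
    show "Ustar < num_basic L t" using start by (simp add: N_def)
    show "0 < m" using assms(5) by (simp add: m_def)
    show "1 < \<gamma>" by (rule gamma)
    show "\<exists>k<num_basic L t. 0 < u i k" if "i < m" for i
    proof (rule ccontr)
      assume "\<not> ?thesis"
      then have "us ! i = 0\<^sub>v N" using dim(1)[OF that] by (intro eq_vecI) (auto simp: u_def N_def)
      then show False using dim(2)[OF that] by simp
    qed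
    show "\<exists>A. (\<forall>i<m. \<forall>j<m. 0 \<le> A i j) \<and> (\<forall>i<m. \<gamma> \<le> (\<Sum>j<m. A i j)) \<and>
       (\<forall>i<m. \<forall>k<num_basic L t. (\<Sum>j<m. A i j * real (u j k))
          \<le> (\<Sum>j<num_basic L t. real (u i j) * (p ^ S' * word_count \<theta>s j k)))" if \<theta>s: "\<theta>s \<in> finite_words L S'" for \<theta>s
    proof -
      obtain A where A: "A \<in> carrier_mat m m" "\<forall>i < m. \<forall>j < m. A $$ (i, j) \<ge> 0"
        "\<forall>i < m. (\<Sum>j<m. A $$ (i, j)) > \<gamma>" "A * rows_mat N us \<le> rows_mat N us * M_word L t p \<theta>s"
        using growth \<theta>s by blast
      have "(\<Sum>j<m. A $$ (i, j) * real (u j k)) \<le> (\<Sum>j<N. real (u i j) * (p ^ S' * word_count \<theta>s j k))"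
        if ik: "i < m" "k < N" for i k
      proof -
        have "(A * rows_mat N us) $$ (i, k) \<le> (rows_mat N us * M_word L t p \<theta>s) $$ (i, k)"
          using A(4) ik rows Mw[of \<theta>s] unfolding less_eq_mat_def by auto
        then show ?thesis
          using ik \<theta>s by (simp add: index_mult_mat_sum[OF A(1) rows] index_mult_mat_sum[OF rows Mw]
              rows_index Mi length_finite_words)
      qed
      then show ?thesis
        using A(2,3) by (intro exI[of _ "\<lambda>i j. A $$ (i, j)"]) (auto simp: N_def less_imp_le)
    qed
    obtain i where i: "i < m" "us ! i = ustar" using start(1) by (auto simp: m_def in_set_conv_nth)
    have "real (u i k) \<le> word_count \<theta>star Ustar k" if k: "k < N" for k
    proof -
      have c: "mat_of_row (unit_vec N Ustar) \<in> carrier_mat 1 N" by simp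
      have "mat_of_row (map_vec real ustar) $$ (0, k) \<le> (mat_of_row (unit_vec N Ustar) * B_word L t \<theta>star) $$ (0, k)"
        using start(3) k Bc[of \<theta>star] unfolding less_eq_mat_def by auto
      also have "\<dots> = (\<Sum>j<N. unit_vec N Ustar $ j * word_count \<theta>star j k)"
        using k by (simp add: index_mult_mat_sum[OF c Bc] Bi)
      also have "\<dots> = (\<Sum>j<N. if j = Ustar then word_count \<theta>star j k else 0)"
        using start(2) by (intro sum.cong) auto
      also have "\<dots> = word_count \<theta>star Ustar k" using start(2) by simp
      finally show ?thesis using k i dim(1)[OF i(1)] by (simp add: u_def)
    qed
    then show "\<exists>i<m. \<forall>k<num_basic L t. real (u i k) \<le> word_count \<theta>star Ustar k"
      using i by (auto simp: N_def)
  qed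
  then interpret covering_issifs L t p u m S' \<gamma> Ustar \<theta>star
    unfolding N_def by (intro covering_issifs.intro coin_issifs_axioms)
  show ?thesis by (rule AE_contains_interval[OF assms(4)])
qed

end
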